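(* Let $d \geq 3$ be an integer. Let $(\delta_0, \delta_1, \ldots, \delta_d)$ be a finite sequence of nonnegative integers with $\delta_0 = 1$, $\delta_1 \geq \delta_d$ and $\sum_{i=0}^{d} \delta_i \leq 3$. Put $s = \max\{ i : \delta_i \neq 0 \}$. Then there exists an integral convex polytope $\mathcal{P} \subset \mathbb{R}^d$ of dimension $d$ whose $\delta$-vector coincides with $(\delta_0, \delta_1, \ldots, \delta_d)$ if and only if $(\delta_0, \delta_1, \ldots, \delta_d)$ satisfies all of the following inequalities: \[ \delta_0 + \delta_1 + \cdots + \delta_i \leq \delta_s + \delta_{s-1} + \cdots + \delta_{s-i} \quad \text{for all } 0 \leq i \leq \lfloor s/2 \rfloor, \] and \[ \delta_{d-1} + \delta_{d-2} + \cdots + \delta_{d-i} \leq \delta_2 + \delta_3 + \cdots + \delta_{i+1} \quad \text{for all } 1 \leq i \leq \lfloor (d-1)/2 \rfloor. \]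
   Context: An integral convex polytope $\mathcal{P} \subset \mathbb{R}^N$ is a convex polytope all of whose vertices have integer coordinates. If $\mathcal{P}$ has dimension $d$, then for each integer $n \geq 1$ put $i(\mathcal{P},n) = |n\mathcal{P} \cap \mathbb{Z}^N|$, where $n\mathcal{P} = \{ n\alpha : \alpha \in \mathcal{P} \}$ and $|X|$ is the cardinality of a finite set $X$. By Ehrhart's theorem $i(\mathcal{P},n)$ is a polynomial in $n$ of degree $d$ with $i(\mathcal{P},0)=1$. Define integers $\delta_0, \delta_1, \delta_2, \ldots$ by the power series identity \[ (1-\lambda)^{d+1}\left[ 1 + \sum_{n=1}^{\infty} i(\mathcal{P},n)\lambda^n \right] = \sum_{i=0}^{\infty} \delta_i \lambda^i . \] It is known that $\delta_i = 0$ for $i > d$. The sequence $\delta(\mathcal{P}) = (\delta_0, \delta_1, \ldots, \delta_d)$ is called the $\delta$-vector of $\mathcal{P}$. *)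

theory Defs
  imports "HOL-Analysis.Analysis" "HOL-Computational_Algebra.Formal_Power_Series"
begin

definition integer_points :: "(real ^ 'n) set" where
  "integer_points = {x. \<forall>i. x $ i \<in> \<int>}"

definition integral_polytope :: "(real ^ 'n) set \<Rightarrow> bool" where
  "integral_polytope P \<longleftrightarrow>
     polytope P \<and> (\<forall>v. v extreme_point_of P \<longrightarrow> v \<in> integer_points)"

definition ehrhart_count :: "(real ^ 'n) set \<Rightarrow> nat \<Rightarrow> nat" where
  "ehrhart_count P n = card ((\<lambda>x. real n *\<^sub>R x) ` P \<inter> integer_points)"

definition ehrhart_series :: "(real ^ 'n) set \<Rightarrow> int fps" where
  "ehrhart_series P = Abs_fps (\<lambda>n. if n = 0 then 1 else int (ehrhart_count P n))"

text \<open>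
  The dimension \<open>d\<close> of \<open>P\<close> is the affine dimension, an \<open>int\<close> that is \<open>-1\<close> for the empty set;
  the definitions below are meant for nonempty \<open>P\<close>.
\<close>

definition delta_coeff :: "(real ^ 'n) set \<Rightarrow> nat \<Rightarrow> int" where
  "delta_coeff P i = fps_nth ((1 - fps_X) ^ (nat (aff_dim P) + 1) * ehrhart_series P) i"

definition delta_vector :: "(real ^ 'n) set \<Rightarrow> int list" where
  "delta_vector P = map (delta_coeff P) [0..<nat (aff_dim P) + 1]"

end

theory Submission
  imports Defs
begin

text \<open>
  Since \<open>\<delta> 0 = 1\<close>, a sequence with sum at most three has at most two further units, at positions
  \<open>a \<le> b\<close>. For such a sequence the two families of inequalities say nothing if there is no further
  unit, \<open>2 k \<le> d + 1\<close> if there is a single one at \<open>k\<close>, and \<open>b \<le> 2 a\<close> together with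
  \<open>a + b \<le> d + 1\<close> if there are two. So the task is to show that exactly these \<open>\<delta>\<close>-vectors occur.

  Both directions rest on a count of lattice points. Suppose that \<open>P\<close> is the convex hull of
  \<open>d + 2\<close> lattice points, possibly with a repetition, with affine dependence \<open>r\<close>. Every
  point of the cone over \<open>P\<close> has exactly one nonnegative coordinate vector in which some coordinate
  with \<open>r > 0\<close> vanishes. Sorting by the least vanishing coordinate, and removing the
  integer shifts of the other \<open>d + 1\<close> coordinates by the factor \<open>(1 - X)\<close> to the power \<open>d + 1\<close>,
  shows that \<open>\<delta>\<^sub>n\<close> is the number of points of height \<open>n\<close> in certain half-open boxes
  (\<open>delta_coeff_eq\<close>).

  Sufficiency: a simplex has one box, which is a finite group, and simplices whose
  group is cyclic of order one, two or three with the required heights can be written down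
  (\<open>simplex_with_cyclic_boxes\<close>).

  Necessity: \<open>\<delta>\<^sub>1\<close> is the number of lattice points of \<open>P\<close> minus \<open>d + 1\<close>. If \<open>a > 1\<close>, then \<open>P\<close> is a
  simplex without lattice points other than its vertices, and comparing a box point with its
  inverse and its double yields the bounds (\<open>singleton_circuit_bounds\<close>). If \<open>a = 1 < b\<close>, then \<open>P\<close>
  has \<open>d + 2\<close> lattice points. Unless \<open>P\<close> is again a simplex, or \<open>b = 2\<close>, the dependence has two
  coefficients of each sign, and moving the box point of height \<open>b\<close> along \<open>r\<close> shows that it has at
  most three nonzero coordinates, all less than \<open>1\<close>, so that \<open>b \<le> 2\<close>
  (\<open>quadrilateral_circuit_bound\<close>).
\<close>

section \<open>Lattice points, convex hulls and generating functions\<close>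

lemma finite_bounded_integer_points:
  fixes S :: "(real ^ 'n) set"
  assumes "bounded S"
  shows "finite (S \<inter> integer_points)"
proof -
  obtain B where B: "\<And>x. x \<in> S \<Longrightarrow> norm x \<le> B"
    using assms bounded_iff by blast
  let ?T = "{k::real. k \<in> \<int> \<and> \<bar>k\<bar> \<le> B}"
  have "finite (vec_lambda ` (PiE UNIV (\<lambda>_::'n. ?T)))"
    by (intro finite_imageI finite_PiE finite_abs_int_segment) auto
  moreover have "S \<inter> integer_points \<subseteq> vec_lambda ` (PiE UNIV (\<lambda>_::'n. ?T))"
  proof
    fix x assume x: "x \<in> S \<inter> integer_points"
    have "x = vec_lambda (vec_nth x)" by simp
    moreover have "vec_nth x \<in> PiE UNIV (\<lambda>_::'n. ?T)"
      using x B order_trans[OF component_le_norm_cart B]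
      by (auto simp: integer_points_def)
    ultimately show "x \<in> vec_lambda ` (PiE UNIV (\<lambda>_::'n. ?T))" by blast
  qed
  ultimately show ?thesis by (rule rev_finite_subset)
qed

lemma convex_hull_image_eq:
  fixes v :: "'i \<Rightarrow> 'a::real_vector"
  assumes "finite I"
  shows "convex hull (v ` I)
    = {y. \<exists>u. (\<forall>i\<in>I. 0 \<le> u i) \<and> sum u I = 1 \<and> (\<Sum>i\<in>I. u i *\<^sub>R v i) = y}"
    (is "_ = ?C")
proof
  show "convex hull (v ` I) \<subseteq> ?C"
  proof (rule hull_minimal)
    show "v ` I \<subseteq> ?C"
    proof clarify
      fix i assume "i \<in> I"
      then show "\<exists>u. (\<forall>i\<in>I. 0 \<le> u i) \<and> sum u I = 1 \<and> (\<Sum>i\<in>I. u i *\<^sub>R v i) = v i"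
        by (intro exI[of _ "\<lambda>j. if j = i then 1 else 0"])
          (auto simp: assms if_distrib[of "\<lambda>c. c *\<^sub>R _"] cong: if_cong)
    qed
    show "convex ?C"
    proof (rule convexI, clarify)
      fix a b :: real and u w :: "'i \<Rightarrow> real"
      assume *: "0 \<le> a" "0 \<le> b" "a + b = 1" "\<forall>i\<in>I. 0 \<le> u i" "\<forall>i\<in>I. 0 \<le> w i"
        "sum u I = 1" "sum w I = 1"
      show "\<exists>z. (\<forall>i\<in>I. 0 \<le> z i) \<and> sum z I = 1 \<and> (\<Sum>i\<in>I. z i *\<^sub>R v i) =
         a *\<^sub>R (\<Sum>i\<in>I. u i *\<^sub>R v i) + b *\<^sub>R (\<Sum>i\<in>I. w i *\<^sub>R v i)"
        using * by (intro exI[of _ "\<lambda>i. a * u i + b * w i"])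
          (auto simp: sum.distrib algebra_simps scaleR_sum_right simp flip: sum_distrib_left)
    qed
  qed
  show "?C \<subseteq> convex hull (v ` I)"
  proof clarify
    fix u assume "\<forall>i\<in>I. 0 \<le> (u i :: real)" "sum u I = 1"
    then show "(\<Sum>i\<in>I. u i *\<^sub>R v i) \<in> convex hull (v ` I)"
      by (intro convex_sum[OF assms convex_convex_hull]) (auto simp: hull_inc)
  qed
qed

text \<open>
  A coordinate that may grow by \<open>1\<close> without limit contributes one factor \<open>1 / (1 - X)\<close>. The set
  \<open>V i\<close> collects the values in \<open>U i\<close> that cannot be lowered by \<open>1\<close>, so that every value in
  \<open>U i\<close> is one of them raised finitely often; multiplying by \<open>1 - X\<close> removes the functions
  that come from another one by raising coordinate \<open>i\<close>, and leaves those with value in \<open>V i\<close>.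
\<close>

lemma free_coordinates_generating_function:
  fixes I S :: "'i set"
    and \<Lambda> :: "('i \<Rightarrow> real) set" and U V :: "'i \<Rightarrow> real set"
  defines "W \<equiv> \<lambda>T n. {f \<in> \<Lambda>. (\<forall>i\<in>I. f i \<in> (if i \<in> T then U i else V i)) \<and> sum f I = real n}"
  assumes I: "finite I" "S \<subseteq> I"
    and shift: "\<And>f i. f \<in> \<Lambda> \<Longrightarrow> i \<in> S \<Longrightarrow> f(i := f i + 1) \<in> \<Lambda> \<and> f(i := f i - 1) \<in> \<Lambda>"
    and up: "\<And>i x. i \<in> S \<Longrightarrow> x \<in> U i \<Longrightarrow> x + 1 \<in> U i"
    and V: "\<And>i. i \<in> S \<Longrightarrow> V i = {x \<in> U i. x - 1 \<notin> U i}"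
    and nonneg: "\<And>i x. i \<in> I \<Longrightarrow> x \<in> U i \<union> V i \<Longrightarrow> 0 \<le> x"
    and fin: "\<And>n. finite (W S n)"
  shows "(1 - fps_X) ^ card S * Abs_fps (\<lambda>n. int (card (W S n)))
    = Abs_fps (\<lambda>n. int (card (W {} n)))"
proof -
  let ?G = "\<lambda>T. Abs_fps (\<lambda>n. int (card (W T n)))"
  have finW: "finite (W T n)" if "T \<subseteq> S" for T n
  proof (rule finite_subset[OF _ fin[of n]])
    show "W T n \<subseteq> W S n"
    proof
      fix f assume f: "f \<in> W T n"
      have "f i \<in> (if i \<in> S then U i else V i)" if "i \<in> I" for i
        using f that \<open>T \<subseteq> S\<close> V[of i] unfolding W_def by (auto split: if_splits)
      then show "f \<in> W S n" using f unfolding W_def by auto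
    qed
  qed
  have step: "(1 - fps_X) * ?G (insert i T) = ?G T"
    if T: "insert i T \<subseteq> S" "i \<notin> T" for i T
  proof -
    let ?up = "\<lambda>f::'i \<Rightarrow> real. f(i := f i + 1)"
    let ?dn = "\<lambda>f::'i \<Rightarrow> real. f(i := f i - 1)"
    have iI: "i \<in> I" "i \<in> S" using T I by auto
    have sum_upd: "sum (f(i := f i + c)) I = sum f I + c" for f :: "'i \<Rightarrow> real" and c
    proof -
      have "sum (f(i := f i + c)) I = sum (\<lambda>j. f j + (if j = i then c else 0)) I"
        by (rule sum.cong) auto
      also have "\<dots> = sum f I + c" using iI I by (simp add: sum.distrib)
      finally show ?thesis .
    qed
    have sum_dn: "sum (?dn f) I = sum f I - 1" for f
      using sum_upd[of f "-1"] by simp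
    have Vi: "x \<in> V i \<longleftrightarrow> x \<in> U i \<and> x - 1 \<notin> U i" for x using V iI by auto
    \<comment> \<open>\<open>W T\<close> consists of the members of \<open>W (insert i T)\<close> whose coordinate \<open>i\<close> is minimal;
      the other members are the raised copies of \<open>W (insert i T)\<close> itself.\<close>
    have lower: "f \<in> W T n" if "f \<in> W (insert i T) n" "f i - 1 \<notin> U i" for f n
    proof -
      have "f i \<in> V i" using that iI Vi unfolding W_def by fastforce
      then have "f j \<in> (if j \<in> T then U j else V j)" if "j \<in> I" for j
        using \<open>f \<in> W (insert i T) n\<close> that T unfolding W_def by (cases "j = i") (auto split: if_splits)
      then show ?thesis using that unfolding W_def by auto
    qed
    have raise: "f \<in> W (insert i T) n \<and> f i - 1 \<notin> U i" if "f \<in> W T n" for f n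
    proof -
      have "f i \<in> V i" using that iI T unfolding W_def by fastforce
      then have "f j \<in> (if j \<in> insert i T then U j else V j)" if "j \<in> I" for j
        using \<open>f \<in> W T n\<close> that T Vi unfolding W_def by (cases "j = i") (auto split: if_splits)
      then show ?thesis using that \<open>f i \<in> V i\<close> Vi unfolding W_def by auto
    qed
    have dn_in: "sum (?dn f) I \<ge> 0 \<and> (\<forall>j\<in>I. ?dn f j \<in> (if j \<in> insert i T then U j else V j)) \<and> ?dn f \<in> \<Lambda>"
      if "f \<in> W (insert i T) n" "f i - 1 \<in> U i" for f n
    proof -
      have *: "?dn f j \<in> (if j \<in> insert i T then U j else V j)" if "j \<in> I" for j
        using \<open>f \<in> W (insert i T) n\<close> \<open>f i - 1 \<in> U i\<close> that unfolding W_def by auto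
      have "0 \<le> ?dn f j" if "j \<in> I" for j
        using nonneg[OF that] *[OF that] by (metis UnCI)
      then have "sum (?dn f) I \<ge> 0" by (rule sum_nonneg)
      then show ?thesis using * shift[of f i] that iI unfolding W_def by blast
    qed
    have c0: "card (W (insert i T) 0) = card (W T 0)"
    proof -
      have "f i - 1 \<notin> U i" if "f \<in> W (insert i T) 0" for f
        using dn_in[OF that] that sum_dn[of f] unfolding W_def by auto
      then have "W (insert i T) 0 = W T 0" using lower raise by blast
      then show ?thesis by simp
    qed
    have cS: "card (W (insert i T) (Suc n)) = card (W T (Suc n)) + card (W (insert i T) n)" for n
    proof -
      have "W (insert i T) (Suc n) = W T (Suc n) \<union> ?up ` W (insert i T) n" (is "?A = ?B \<union> ?C")
      proof (intro subset_antisym subsetI)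
        fix f assume f: "f \<in> ?A"
        show "f \<in> ?B \<union> ?C"
        proof (cases "f i - 1 \<in> U i")
          case True
          have "?dn f \<in> W (insert i T) n"
            using dn_in[OF f True] f sum_dn[of f] unfolding W_def by auto
          moreover have "f = ?up (?dn f)" by simp
          ultimately show ?thesis by blast
        next
          case False
          then show ?thesis using lower[OF f] by blast
        qed
      next
        fix f assume "f \<in> ?B \<union> ?C"
        then show "f \<in> ?A"
        proof
          assume "f \<in> ?C"
          then obtain g where g: "g \<in> W (insert i T) n" "f = ?up g" by blast
          have "f \<in> \<Lambda>" using g shift[of g i] iI unfolding W_def by auto
          moreover have "f j \<in> (if j \<in> insert i T then U j else V j)" if "j \<in> I" for j
            using g that up[of i] iI unfolding W_def by auto
          moreover have "sum f I = real (Suc n)"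
            using g sum_upd[of g 1] unfolding W_def by auto
          ultimately show "f \<in> ?A" unfolding W_def by blast
        qed (use raise in blast)
      qed
      moreover have "?B \<inter> ?C = {}"
      proof -
        have "g i \<in> U i" if "g \<in> W (insert i T) n" for g
          using that iI unfolding W_def by auto
        then show ?thesis using raise by fastforce
      qed
      moreover have "card ?C = card (W (insert i T) n)"
      proof (rule card_image, rule inj_onI)
        fix f g assume "?up f = ?up g"
        then have "f j = g j" for j by (metis add_right_cancel fun_upd_apply)
        then show "f = g" by blast
      qed
      ultimately show ?thesis
        using T finW by (simp add: card_Un_disjoint)
    qed
    show ?thesis
    proof (rule fps_ext)
      fix n show "fps_nth ((1 - fps_X) * ?G (insert i T)) n = fps_nth (?G T) n"
        by (cases n) (auto simp: left_diff_distrib c0 cS)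
    qed
  qed
  have "T \<subseteq> S \<Longrightarrow> (1 - fps_X) ^ card T * ?G T = ?G {}" if "finite T" for T
    using that
  proof (induction T rule: finite_induct)
    case (insert i T)
    have "(1 - fps_X) ^ card (insert i T) * ?G (insert i T)
      = (1 - fps_X) ^ card T * ((1 - fps_X) * ?G (insert i T))"
      using insert.hyps by (simp add: algebra_simps)
    also have "(1 - fps_X) * ?G (insert i T) = ?G T"
      using step[of i T] insert by blast
    also have "(1 - fps_X) ^ card T * ?G T = ?G {}"
      using insert by blast
    finally show ?case .
  qed simp
  then show ?thesis using I finite_subset by blast
qed

section \<open>The delta-vector of a lattice circuit\<close>

text \<open>
  A full-dimensional configuration of \<open>CARD('n) + 2\<close> lattice points carries exactly one affine
  dependence \<open>r\<close> up to scaling. Repetitions among the points are allowed: a simplex is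
  included by listing one of its vertices twice.
\<close>

locale lattice_circuit =
  fixes I :: "nat set" and v :: "nat \<Rightarrow> real ^ 'n" and r :: "nat \<Rightarrow> real"
  assumes finite_I: "finite I" and card_I: "card I = CARD('n) + 2"
    and lattice: "\<And>i. i \<in> I \<Longrightarrow> v i \<in> integer_points"
    and full_dim: "aff_dim (convex hull (v ` I)) = int CARD('n)"
    and r_outside: "\<And>i. i \<notin> I \<Longrightarrow> r i = 0"
    and r_nonzero: "\<exists>i\<in>I. r i \<noteq> 0"
    and r_sum: "sum r I = 0" and r_dep: "(\<Sum>i\<in>I. r i *\<^sub>R v i) = 0"
    and dep_unique: "\<And>s. sum s I = 0 \<Longrightarrow> (\<Sum>i\<in>I. s i *\<^sub>R v i) = 0 \<Longrightarrow> \<exists>c. \<forall>i\<in>I. s i = c * r i"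
begin

abbreviation "P \<equiv> convex hull (v ` I)"

definition "pos = {i \<in> I. 0 < r i}"

definition comb :: "(nat \<Rightarrow> real) \<Rightarrow> real ^ 'n" where
  "comb f = (\<Sum>i\<in>I. f i *\<^sub>R v i)"

text \<open>
  The coordinate vectors of all points of \<open>\<int>\<^sup>n \<times> \<int>\<close>, the cone over \<open>P\<close> being generated by the
  points \<open>(v i, 1)\<close>. This is a group that contains the integer vectors and the line spanned by
  \<open>r\<close>. Forcing the value \<open>0\<close> outside \<open>I\<close> makes equal vectors equal functions.
\<close>

definition coords :: "(nat \<Rightarrow> real) set" where
  "coords = {f. (\<forall>i. i \<notin> I \<longrightarrow> f i = 0) \<and> sum f I \<in> \<int> \<and> comb f \<in> integer_points}"

text \<open>
  The preferred nonnegative coordinate vectors of height \<open>n\<close>: those that cannot be pushed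
  any further against \<open>r\<close>.
\<close>

definition slab :: "nat \<Rightarrow> (nat \<Rightarrow> real) set" where
  "slab n = {f \<in> coords. (\<forall>i\<in>I. 0 \<le> f i) \<and> (\<exists>a\<in>pos. f a = 0) \<and> sum f I = real n}"

text \<open>
  The half-open boxes of the triangulation of \<open>P\<close> whose cells omit one vertex in \<open>pos\<close>. A
  facet shared by several cells is kept in the cell with the least omitted index, which turns
  some of the intervals \<open>[0, 1)\<close> into \<open>(0, 1]\<close>.
\<close>

definition box :: "nat \<Rightarrow> (nat \<Rightarrow> real) set" where
  "box a = {f \<in> coords. f a = 0 \<and>
     (\<forall>i\<in>I - {a}. f i \<in> (if i \<in> pos \<and> i < a then {0<..1} else {0..<1}))}"

definition box_at :: "nat \<Rightarrow> nat \<Rightarrow> (nat \<Rightarrow> real) set" where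
  "box_at a n = {f \<in> box a. sum f I = real n}"

lemma finite_pos: "finite pos"
  unfolding pos_def using finite_I by simp

lemma pos_nonempty: "pos \<noteq> {}"
proof
  assume "pos = {}"
  then have "\<forall>i\<in>I. 0 \<le> - r i" unfolding pos_def by force
  moreover have "sum (\<lambda>i. - r i) I = 0" using r_sum by (simp add: sum_negf)
  ultimately have "\<forall>i\<in>I. - r i = 0"
    using finite_I sum_nonneg_eq_0_iff[of I "\<lambda>i. - r i"] by blast
  then show False using r_nonzero by auto
qed

lemma neg_exists: "\<exists>i\<in>I. r i < 0"
proof (rule ccontr)
  assume "\<not> (\<exists>i\<in>I. r i < 0)"
  then have "\<forall>i\<in>I. 0 \<le> r i" by force
  then have "\<forall>i\<in>I. r i = 0"
    using r_sum finite_I sum_nonneg_eq_0_iff[of I r] by blast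
  then show False using r_nonzero by auto
qed

lemma pos_subset: "pos \<subseteq> I" unfolding pos_def by auto

lemma dilate_0: "(\<lambda>x. real 0 *\<^sub>R x) ` P = {0}"
  using pos_nonempty pos_subset by (auto simp: image_constant_conv)

lemma comb_add: "comb (\<lambda>i. f i + g i) = comb f + comb g"
  unfolding comb_def by (simp add: algebra_simps sum.distrib)

lemma comb_diff: "comb (\<lambda>i. f i - g i) = comb f - comb g"
  unfolding comb_def by (simp add: algebra_simps sum_subtractf)

lemma comb_scale: "comb (\<lambda>i. c * f i) = c *\<^sub>R comb f"
  unfolding comb_def by (simp add: scaleR_sum_right)

lemma comb_integral: "(\<And>i. i \<in> I \<Longrightarrow> f i \<in> \<int>) \<Longrightarrow> comb f \<in> integer_points"
  using lattice unfolding comb_def integer_points_def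
  by (auto intro!: Ints_sum Ints_mult)

lemma coords_add: "f \<in> coords \<Longrightarrow> g \<in> coords \<Longrightarrow> (\<lambda>i. f i + g i) \<in> coords"
  unfolding coords_def by (auto simp: comb_add sum.distrib integer_points_def)

lemma coords_diff: "f \<in> coords \<Longrightarrow> g \<in> coords \<Longrightarrow> (\<lambda>i. f i - g i) \<in> coords"
  unfolding coords_def by (auto simp: comb_diff sum_subtractf integer_points_def)

lemma coords_integral:
  "(\<And>i. i \<in> I \<Longrightarrow> f i \<in> \<int>) \<Longrightarrow> (\<And>i. i \<notin> I \<Longrightarrow> f i = 0) \<Longrightarrow> f \<in> coords"
  unfolding coords_def by (auto intro: comb_integral)

lemma coords_dep: "(\<lambda>i. t * r i) \<in> coords"
proof -
  have "sum (\<lambda>i. t * r i) I = 0" using r_sum by (simp flip: sum_distrib_left)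
  moreover have "comb (\<lambda>i. t * r i) = 0"
    using r_dep by (simp add: comb_scale, simp add: comb_def)
  ultimately show ?thesis using r_outside by (auto simp: coords_def integer_points_def)
qed

lemma coords_frac:
  assumes "f \<in> coords"
  shows "(\<lambda>i. frac (f i)) \<in> coords"
proof -
  have "(\<lambda>i. of_int \<lfloor>f i\<rfloor>) \<in> coords"
    using assms by (intro coords_integral) (auto simp: coords_def)
  from coords_diff[OF assms this] show ?thesis by (simp add: frac_def)
qed

lemma coords_upd:
  assumes "f \<in> coords" "i \<in> I" "c \<in> \<int>"
  shows "f(i := f i + c) \<in> coords"
proof -
  have "(\<lambda>j. if j = i then c else 0) \<in> coords"
    using assms by (intro coords_integral) auto
  from coords_add[OF assms(1) this] show ?thesis
    by (rule back_subst[of "\<lambda>f. f \<in> coords"]) auto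
qed

text \<open>
  Two coordinate vectors of the same point differ by a multiple of \<open>r\<close>. Subtracting as large a
  multiple of \<open>r\<close> as nonnegativity permits makes a coordinate in \<open>pos\<close> vanish, and this happens
  for one multiple only.
\<close>

lemma slab_bij: "bij_betw comb (slab n) ((\<lambda>x. real n *\<^sub>R x) ` P \<inter> integer_points)"
proof (rule bij_betwI')
  fix f g assume f: "f \<in> slab n" and g: "g \<in> slab n"
  show "comb f = comb g \<longleftrightarrow> f = g"
  proof
    assume eq: "comb f = comb g"
    have "sum (\<lambda>i. f i - g i) I = 0" using f g by (simp add: slab_def sum_subtractf)
    moreover have "(\<Sum>i\<in>I. (f i - g i) *\<^sub>R v i) = 0"
      using eq comb_diff[of f g] by (simp add: comb_def)
    ultimately obtain c where c: "\<And>i. i \<in> I \<Longrightarrow> f i - g i = c * r i"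
      using dep_unique[of "\<lambda>i. f i - g i"] by auto
    obtain a b where a: "a \<in> pos" "f a = 0" and b: "b \<in> pos" "g b = 0"
      using f g unfolding slab_def by blast
    have "c * r a \<le> 0" "0 \<le> c * r b"
      using c[of a] c[of b] a b pos_subset f g unfolding slab_def by fastforce+
    then have "c = 0" using a b unfolding pos_def
      by (metis (no_types, lifting) mem_Collect_eq mult_le_0_iff zero_le_mult_iff dual_order.antisym not_less)
    show "f = g"
    proof
      fix i show "f i = g i"
        using c[of i] \<open>c = 0\<close> f g by (cases "i \<in> I") (auto simp: slab_def coords_def)
    qed
  qed simp
next
  fix f assume f: "f \<in> slab n"
  then have "comb f \<in> integer_points" by (simp add: slab_def coords_def)
  moreover have "comb f \<in> (\<lambda>x. real n *\<^sub>R x) ` P"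
  proof (cases "n = 0")
    case True
    have "sum f I = 0" "\<forall>i\<in>I. 0 \<le> f i" using f True by (auto simp: slab_def)
    then have "\<forall>i\<in>I. f i = 0" using finite_I sum_nonneg_eq_0_iff[of I f] by blast
    then have "comb f = 0" by (simp add: comb_def)
    then show ?thesis using True dilate_0 by auto
  next
    case False
    have "(\<Sum>i\<in>I. (1 / real n * f i) *\<^sub>R v i) \<in> P"
      unfolding convex_hull_image_eq[OF finite_I] using f False
      by (intro CollectI exI[of _ "\<lambda>i. 1 / real n * f i"])
        (auto simp: slab_def simp flip: sum_divide_distrib)
    then have "comb (\<lambda>i. 1 / real n * f i) \<in> P" by (simp only: comb_def)
    moreover have "comb f = real n *\<^sub>R comb (\<lambda>i. 1 / real n * f i)"
      using False by (simp only: comb_scale) simp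
    ultimately show ?thesis by blast
  qed
  ultimately show "comb f \<in> (\<lambda>x. real n *\<^sub>R x) ` P \<inter> integer_points" by blast
next
  fix y assume y: "y \<in> (\<lambda>x. real n *\<^sub>R x) ` P \<inter> integer_points"
  then obtain u where u: "\<forall>i\<in>I. 0 \<le> u i" "sum u I = 1"
    and yu: "y = real n *\<^sub>R (\<Sum>i\<in>I. u i *\<^sub>R v i)"
    unfolding convex_hull_image_eq[OF finite_I] by auto
  define f where "f i = (if i \<in> I then real n * u i else 0)" for i
  have f: "\<And>i. i \<in> I \<Longrightarrow> 0 \<le> f i" "sum f I = real n" "comb f = y"
    using u yu unfolding f_def comb_def
    by (auto simp: scaleR_sum_right simp flip: sum_distrib_left)
  have fc: "f \<in> coords" using f y by (auto simp: coords_def) (simp add: f_def)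
  \<comment> \<open>The coordinate in \<open>pos\<close> that reaches \<open>0\<close> first when \<open>f\<close> moves against \<open>r\<close>.\<close>
  define a where "a = arg_min_on (\<lambda>i. f i / r i) pos"
  have a: "a \<in> pos" "\<And>i. i \<in> pos \<Longrightarrow> f a / r a \<le> f i / r i"
    unfolding a_def
    using arg_min_if_finite(1)[OF finite_pos pos_nonempty, of "\<lambda>i. f i / r i"]
      arg_min_least[OF finite_pos pos_nonempty, of _ "\<lambda>i. f i / r i"] by auto
  define t where "t = f a / r a"
  define g where "g i = f i - t * r i" for i
  have ra: "r a > 0" "a \<in> I" using a by (auto simp: pos_def)
  have t0: "t \<ge> 0" using f ra by (simp add: t_def)
  have "g \<in> coords" unfolding g_def by (intro coords_diff fc coords_dep)
  moreover have "g i \<ge> 0" if "i \<in> I" for i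
  proof (cases "i \<in> pos")
    case True
    then have "t * r i \<le> f i" using a(2)[OF True] by (simp add: pos_def t_def field_simps)
    then show ?thesis by (simp add: g_def)
  next
    case False
    then have "t * r i \<le> 0" using that t0 by (simp add: pos_def mult_le_0_iff)
    then show ?thesis using f(1)[OF that] by (simp add: g_def)
  qed
  moreover have "g a = 0" using ra by (simp add: g_def t_def)
  moreover have "sum g I = real n"
    using f r_sum by (simp add: g_def sum_subtractf flip: sum_distrib_left)
  ultimately have "g \<in> slab n" using a unfolding slab_def by blast
  moreover have "comb g = y"
    unfolding g_def using f r_dep by (simp add: comb_diff comb_scale, simp add: comb_def)
  ultimately show "\<exists>g\<in>slab n. y = comb g" by blast
qed

lemma finite_slab: "finite (slab n)"
proof -
  have "bounded P" using finite_I by (simp add: bounded_convex_hull finite_imp_bounded)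
  then have "bounded ((\<lambda>x. real n *\<^sub>R x) ` P)" by (rule bounded_scaling)
  then show ?thesis
    using finite_bounded_integer_points slab_bij bij_betw_finite by blast
qed

text \<open>
  At height \<open>0\<close> both sides count one point, so the constant term of the series fits as well.
\<close>

lemma ehrhart_series_eq: "ehrhart_series P = Abs_fps (\<lambda>n. int (card (slab n)))"
proof -
  have "card (slab n) = ehrhart_count P n" for n
    using bij_betw_same_card[OF slab_bij] by (simp add: ehrhart_count_def)
  moreover have "ehrhart_count P 0 = 1"
  proof -
    have "(\<lambda>x. real 0 *\<^sub>R x) ` P \<inter> integer_points = {0}"
      unfolding dilate_0 by (auto simp: integer_points_def)
    then show ?thesis by (simp only: ehrhart_count_def card.insert) simp
  qed
  ultimately show ?thesis unfolding ehrhart_series_def by (intro fps_ext) simp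
qed

definition part :: "nat \<Rightarrow> nat \<Rightarrow> (nat \<Rightarrow> real) set" where
  "part a n = {f \<in> slab n. f a = 0 \<and> (\<forall>i\<in>pos. i < a \<longrightarrow> 0 < f i)}"

lemma card_slab: "card (slab n) = (\<Sum>a\<in>pos. card (part a n))"
proof -
  have "slab n = (\<Union>a\<in>pos. part a n)"
  proof (intro subset_antisym subsetI)
    fix f assume f: "f \<in> slab n"
    define a where "a = Min {a \<in> pos. f a = 0}"
    have *: "finite {a \<in> pos. f a = 0}" "{a \<in> pos. f a = 0} \<noteq> {}"
      using finite_pos f by (auto simp: slab_def)
    then have "a \<in> {a \<in> pos. f a = 0}" unfolding a_def by (rule Min_in)
    moreover have "f i \<noteq> 0" if "i \<in> pos" "i < a" for i
      using Min_le[OF *(1), of i] that unfolding a_def by auto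
    moreover have "f i \<ge> 0" if "i \<in> pos" for i
      using f that pos_subset by (auto simp: slab_def)
    ultimately show "f \<in> (\<Union>a\<in>pos. part a n)"
      using f unfolding part_def by (auto simp: order_less_le)
  qed (auto simp: part_def)
  moreover have "card (\<Union>a\<in>pos. part a n) = (\<Sum>a\<in>pos. card (part a n))"
  proof (rule card_UN_disjoint)
    show "\<forall>a\<in>pos. finite (part a n)"
      using finite_slab by (simp add: part_def)
    show "\<forall>a\<in>pos. \<forall>b\<in>pos. a \<noteq> b \<longrightarrow> part a n \<inter> part b n = {}"
    proof (intro ballI impI)
      fix a b :: nat assume "a \<in> pos" "b \<in> pos" "a \<noteq> b"
      then show "part a n \<inter> part b n = {}"
        unfolding part_def by (cases a b rule: linorder_cases) fastforce+
    qed
  qed (rule finite_pos)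
  ultimately show ?thesis by simp
qed

lemma part_series:
  assumes a: "a \<in> pos"
  shows "(1 - fps_X) ^ (CARD('n) + 1) * Abs_fps (\<lambda>n. int (card (part a n)))
    = Abs_fps (\<lambda>n. int (card (box_at a n)))"
proof -
  have aI: "a \<in> I" using a pos_subset by auto
  define U :: "nat \<Rightarrow> real set" where
    "U i = (if i = a then {0} else if i \<in> pos \<and> i < a then {0<..} else {0..})" for i
  define V :: "nat \<Rightarrow> real set" where
    "V i = (if i = a then {0} else if i \<in> pos \<and> i < a then {0<..1} else {0..<1})" for i
  have part: "part a n = {f \<in> coords. (\<forall>i\<in>I. f i \<in> (if i \<in> I - {a} then U i else V i))
      \<and> sum f I = real n}" for n
  proof (intro subset_antisym subsetI)
    fix f assume "f \<in> part a n"
    then show "f \<in> {f \<in> coords. (\<forall>i\<in>I. f i \<in> (if i \<in> I - {a} then U i else V i))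
      \<and> sum f I = real n}" unfolding part_def slab_def U_def V_def by auto
  next
    fix f assume f: "f \<in> {f \<in> coords. (\<forall>i\<in>I. f i \<in> (if i \<in> I - {a} then U i else V i))
      \<and> sum f I = real n}"
    then have fi: "f i \<in> (if i \<in> I - {a} then U i else V i)" if "i \<in> I" for i using that by blast
    have "f a = 0" using fi[OF aI] by (simp add: V_def)
    moreover have "0 \<le> f i" if "i \<in> I" for i
      using fi[OF that] that by (auto simp: U_def V_def split: if_splits)
    moreover have "0 < f i" if "i \<in> pos" "i < a" for i
      using fi[of i] that pos_subset by (auto simp: U_def split: if_splits)
    ultimately show "f \<in> part a n" using f a unfolding part_def slab_def by blast
  qed
  have box: "box_at a n = {f \<in> coords. (\<forall>i\<in>I. f i \<in> (if i \<in> {} then U i else V i))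
      \<and> sum f I = real n}" for n
    using aI unfolding box_at_def box_def V_def by auto
  have "(1 - fps_X) ^ card (I - {a}) * Abs_fps (\<lambda>n. int (card (part a n)))
    = Abs_fps (\<lambda>n. int (card (box_at a n)))"
    unfolding part box
  proof (rule free_coordinates_generating_function)
    show "finite I" "I - {a} \<subseteq> I" using finite_I by auto
    fix f i assume "f \<in> coords" "i \<in> I - {a}"
    then show "f(i := f i + 1) \<in> coords \<and> f(i := f i - 1) \<in> coords"
      using coords_upd[of f i 1] coords_upd[of f i "-1"] by auto
  next
    fix n show "finite {f \<in> coords. (\<forall>i\<in>I. f i \<in> (if i \<in> I - {a} then U i else V i))
      \<and> sum f I = real n}"
      unfolding part[symmetric] using finite_slab by (simp add: part_def)
  qed (auto simp: U_def V_def split: if_splits)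
  moreover have "card (I - {a}) = CARD('n) + 1" using card_I finite_I aI by simp
  ultimately show ?thesis by simp
qed

text \<open>
  In the part belonging to \<open>a\<close> the coordinate \<open>a\<close> is fixed and the remaining
  \<open>CARD('n) + 1\<close> are free, which matches the exponent in the definition of the \<open>\<delta>\<close>-vector.
  Hence \<open>\<delta>\<^sub>n\<close> is a plain count of box points of height \<open>n\<close>.
\<close>

theorem delta_coeff_eq: "delta_coeff P n = (\<Sum>a\<in>pos. int (card (box_at a n)))"
proof -
  have "ehrhart_series P = (\<Sum>a\<in>pos. Abs_fps (\<lambda>n. int (card (part a n))))"
    unfolding ehrhart_series_eq by (intro fps_ext) (simp add: card_slab fps_sum_nth)
  then have "(1 - fps_X) ^ (CARD('n) + 1) * ehrhart_series P
      = (\<Sum>a\<in>pos. Abs_fps (\<lambda>n. int (card (box_at a n))))"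
    by (simp only: sum_distrib_left part_series cong: sum.cong)
  then show ?thesis
    unfolding delta_coeff_def using full_dim by (simp add: fps_sum_nth)
qed

end

section \<open>Box points of circuits\<close>

lemma sum_less_card:
  fixes f :: "'i \<Rightarrow> real"
  assumes "finite S" "S \<noteq> {}" "\<And>i. i \<in> S \<Longrightarrow> f i < 1"
  shows "sum f S < real (card S)"
  using sum_strict_mono[of S f "\<lambda>_. 1"] assms by simp

lemma Ints_unit_interval: "x \<in> \<int> \<Longrightarrow> 0 \<le> x \<Longrightarrow> x < 1 \<Longrightarrow> x = (0::real)"
  by (auto elim!: Ints_cases)

context lattice_circuit
begin

lemma sum_upd:
  assumes "i \<in> I"
  shows "sum (f(i := c)) I = sum f I - f i + (c::real)"
proof -
  have "sum (f(i := c)) (I - {i}) = sum f (I - {i})" by (rule sum.cong) auto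
  then show ?thesis
    using sum.remove[OF finite_I assms, of f] sum.remove[OF finite_I assms, of "f(i := c)"]
    by simp
qed

lemma box_in_range:
  assumes "f \<in> box a" "i \<in> I"
  shows "0 \<le> f i" "f i \<le> 1"
proof -
  have "f i \<in> {0..1}"
  proof (cases "i = a")
    case False
    then have "f i \<in> (if i \<in> pos \<and> i < a then {0<..1} else {0..<1})"
      using assms unfolding box_def by blast
    then show ?thesis by (simp split: if_splits)
  qed (use assms in \<open>simp add: box_def\<close>)
  then show "0 \<le> f i" "f i \<le> 1" by auto
qed

lemma box_height:
  assumes "f \<in> box a"
  obtains n where "f \<in> box_at a n"
proof -
  have "sum f I \<ge> 0" using box_in_range[OF assms] by (intro sum_nonneg) auto
  moreover have "sum f I \<in> \<int>" using assms by (simp add: box_def coords_def)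
  ultimately obtain n where "sum f I = real n"
    by (metis Ints_cases nonneg_int_cases of_int_0_le_iff of_int_of_nat_eq)
  then show ?thesis using assms that unfolding box_at_def by blast
qed

lemma box_at_0:
  assumes "f \<in> box_at a 0"
  shows "f i = 0"
proof (cases "i \<in> I")
  case True
  have "f \<in> box a" "sum f I = 0" using assms by (auto simp: box_at_def)
  then show ?thesis
    using True sum_nonneg_eq_0_iff[OF finite_I, of f] box_in_range(1) by blast
next
  case False
  then show ?thesis using assms by (simp add: box_at_def box_def coords_def)
qed

text \<open>
  Only \<open>CARD('n) + 1\<close> coordinates can be nonzero, and a coordinate where \<open>r\<close> is negative stays
  below \<open>1\<close>. Thus all box points are seen by \<open>\<delta>\<^sub>0, \<dots>, \<delta>\<^sub>d\<close>.
\<close>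

lemma box_height_le:
  assumes f: "f \<in> box_at a n" and a: "a \<in> pos"
  shows "n \<le> CARD('n)"
proof -
  obtain b where b: "b \<in> I" "r b < 0" using neg_exists by blast
  have aI: "a \<in> I" using a pos_subset by auto
  have bx: "f \<in> box a" using f by (simp add: box_at_def)
  have "b \<noteq> a" "b \<notin> pos" using a b by (auto simp: pos_def)
  moreover have "f b \<in> (if b \<in> pos \<and> b < a then {0<..1} else {0..<1})"
    using bx b \<open>b \<noteq> a\<close> unfolding box_def by blast
  ultimately have "f b < 1" by simp
  then have "sum f (I - {a}) < sum (\<lambda>_. 1) (I - {a})"
    using box_in_range[OF bx] finite_I b \<open>b \<noteq> a\<close> by (intro sum_strict_mono_ex1) auto
  moreover have "sum f I = sum f (I - {a})"
    using sum.remove[OF finite_I aI, of f] bx by (simp add: box_def)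
  ultimately have "real n < real (CARD('n) + 1)"
    using f card_I finite_I aI by (simp add: box_at_def)
  then show ?thesis by linarith
qed

lemma finite_box_at: "a \<in> pos \<Longrightarrow> finite (box_at a n)"
  by (rule finite_subset[OF _ finite_slab[of n]])
    (auto simp: box_at_def slab_def box_in_range, auto simp: box_def)

lemma delta_coeff_nonneg: "delta_coeff P n \<ge> 0"
  unfolding delta_coeff_eq by (rule sum_nonneg) simp

lemma delta_coeff_pos_iff: "delta_coeff P n > 0 \<longleftrightarrow> (\<exists>a\<in>pos. box_at a n \<noteq> {})"
proof -
  have "delta_coeff P n = 0 \<longleftrightarrow> (\<forall>a\<in>pos. box_at a n = {})"
    unfolding delta_coeff_eq using finite_pos finite_box_at
    by (subst sum_nonneg_eq_0_iff) auto
  then show ?thesis using delta_coeff_nonneg[of n] by force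
qed

lemma box_at_unique:
  assumes one: "delta_coeff P n = 1"
    and f: "a \<in> pos" "f \<in> box_at a n" and g: "b \<in> pos" "g \<in> box_at b n"
  shows "a = b" "f = g"
proof -
  have c1: "card (box_at c n) \<ge> 1" if "c \<in> pos" "h \<in> box_at c n" for c h
    using that finite_box_at[of c n] by (metis card_gt_0_iff empty_iff less_eq_Suc_le One_nat_def)
  have sub: "(\<Sum>c\<in>C. int (card (box_at c n))) \<le> 1" if "C \<subseteq> pos" for C
    using sum_mono2[OF finite_pos that, of "\<lambda>c. int (card (box_at c n))"] one
    unfolding delta_coeff_eq by simp
  show "a = b"
  proof (rule ccontr)
    assume "a \<noteq> b"
    then show False using sub[of "{a,b}"] c1[OF f] c1[OF g] f g by simp
  qed
  then have "f \<in> box_at a n" "g \<in> box_at a n" "card (box_at a n) \<le> 1"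
    using f g sub[of "{a}"] by auto
  then show "f = g" using card_le_Suc0_iff_eq[OF finite_box_at[OF f(1)]] by auto
qed

text \<open>
  For \<open>pos = {a}\<close> the polytope is a simplex and its single box is a group under addition modulo
  \<open>1\<close>. If \<open>f\<close> has height \<open>k\<close>, then \<open>f\<close> and its inverse have total height at most
  \<open>CARD('n) + 1\<close>, because \<open>x + frac (- x) \<le> 1\<close>; and doubling gives height at most \<open>2 k\<close>,
  because \<open>frac (2 x) \<le> 2 x\<close>. For \<open>k \<noteq> l\<close> the only nonzero elements are \<open>f\<close> and \<open>g\<close>, so the
  group has order three, and both \<open>- f\<close> and \<open>2 f\<close> must be the element \<open>g\<close> of height \<open>l\<close>.
\<close>

lemma singleton_circuit_bounds:
  assumes single: "pos = {a}"
    and k: "1 \<le> k" and kl: "k \<le> l"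
    and supp: "\<And>n. 1 \<le> n \<Longrightarrow> n \<le> CARD('n) \<Longrightarrow> n \<noteq> k \<Longrightarrow> n \<noteq> l \<Longrightarrow> delta_coeff P n = 0"
    and posk: "delta_coeff P k > 0" and posl: "delta_coeff P l > 0"
    and one: "k \<noteq> l \<Longrightarrow> delta_coeff P k = 1 \<and> delta_coeff P l = 1"
  shows "l \<le> 2 * k" "k + l \<le> CARD('n) + 1"
proof -
  have aI: "a \<in> I" and ap: "a \<in> pos" using single pos_subset by auto
  define F where "F w = (\<lambda>i. frac (w i))" for w :: "nat \<Rightarrow> real"
  have F_box: "F w \<in> box a" if "w \<in> coords" "w a \<in> \<int>" for w
    using coords_frac[OF that(1)] that(2) single
    by (auto simp: box_def F_def frac_lt_1)
  have range: "0 \<le> w i" "w i < 1" "w a = 0" if "w \<in> box a" "i \<in> I" for w i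
    using that single unfolding box_def by (cases "i = a"; auto)+
  have height: "n = 0 \<or> n = k \<or> n = l" if "w \<in> box_at a n" for w n
  proof (rule ccontr)
    assume "\<not> (n = 0 \<or> n = k \<or> n = l)"
    then have "delta_coeff P n = 0" using supp box_height_le[OF that ap] by auto
    moreover have "delta_coeff P n > 0" using that ap delta_coeff_pos_iff by blast
    ultimately show False by simp
  qed
  obtain f where f: "f \<in> box_at a k" using posk single delta_coeff_pos_iff by auto
  obtain g where g: "g \<in> box_at a l" using posl single delta_coeff_pos_iff by auto
  have fb: "f \<in> box a" "g \<in> box a" and fc: "f \<in> coords" "g \<in> coords"
    using f g by (auto simp: box_at_def box_def)
  have fa: "f a = 0" and ga: "g a = 0" using fb by (auto simp: box_def)
  have uniq: "w = f" if "w \<in> box_at a k" "k \<noteq> l" for w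
    using box_at_unique(2) one f that ap by blast
  have uniq': "w = g" if "w \<in> box_at a l" "k \<noteq> l" for w
    using box_at_unique(2) one g that ap by blast
  have nonint: "\<exists>i\<in>I. w i \<notin> \<int>" if "w \<in> box_at a n" "n \<noteq> 0" for w n
  proof (rule ccontr)
    assume "\<not> ?thesis"
    then have int: "\<And>i. i \<in> I \<Longrightarrow> w i \<in> \<int>" by blast
    have "w \<in> box a" using that by (simp add: box_at_def)
    then have "w i = 0" if "i \<in> I" for i
      using int[OF that] range(1,2)[OF _ that, of w] by (intro Ints_unit_interval) auto
    then have "sum w I = 0" by simp
    then show False using that by (simp add: box_at_def)
  qed
  define N where "N = F (\<lambda>i. - f i)"
  have "(\<lambda>i. - f i) \<in> coords" using coords_diff[of "\<lambda>_. 0" f] fc coords_dep[of 0] by simp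
  then have Nb: "N \<in> box a" unfolding N_def by (intro F_box) (use fa ga in auto)
  then obtain m where m: "N \<in> box_at a m" by (rule box_height)
  have "m \<noteq> 0"
  proof
    assume "m = 0"
    then have "N i = 0" for i using m box_at_0 by blast
    then have "f i \<in> \<int>" for i unfolding N_def F_def by simp
    then show False using nonint[OF f] k by auto
  qed
  have km: "k + m \<le> CARD('n) + 1"
  proof -
    have "f i + N i \<le> (if i = a then 0 else 1)" if "i \<in> I" for i
    proof (cases "i = a")
      case True
      then show ?thesis using range[OF fb(1) aI] range[OF Nb aI] by simp
    next
      case False
      then show ?thesis using range[OF fb(1) that] frac_eq[of "f i"]
        by (auto simp: N_def F_def frac_neg)
    qed
    then have "sum (\<lambda>i. f i + N i) I \<le> (\<Sum>i\<in>I. if i = a then 0 else 1)" by (rule sum_mono)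
    also have "\<dots> = (\<Sum>i\<in>I - {a}. 1)"
      using finite_I aI by (subst sum.remove[of _ a]) auto
    also have "\<dots> = real (CARD('n) + 1)" using card_I finite_I aI by simp
    finally have "real (k + m) \<le> real (CARD('n) + 1)"
      using f m by (simp add: box_at_def sum.distrib)
    then show ?thesis by linarith
  qed
  show "k + l \<le> CARD('n) + 1" "l \<le> 2 * k"
  proof (atomize (full), cases "k = l")
    case True
    then show "k + l \<le> CARD('n) + 1 \<and> l \<le> 2 * k"
      using height[OF m] \<open>m \<noteq> 0\<close> km by auto
  next
    case False
    \<comment> \<open>If \<open>f\<close> were its own inverse, then \<open>f + g\<close> would be a further element.\<close>
    have "N \<noteq> f"
    proof
      assume Nf: "N = f"
      define s where "s = F (\<lambda>i. f i + g i)"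
      have sb: "s \<in> box a" unfolding s_def
        by (intro F_box coords_add fc) (use fa ga in auto)
      then obtain n where n: "s \<in> box_at a n" by (rule box_height)
      consider "n = 0" | "s = f" | "s = g"
        using height[OF n] n uniq uniq' False by blast
      then show False
      proof cases
        case 1
        have "g i = N i" if "i \<in> I" for i
        proof -
          have "f i + g i \<in> \<int>" using 1 n box_at_0[of s a i] by (simp add: s_def F_def)
          then have "- f i - g i \<in> \<int>" using Ints_minus by fastforce
          then have "frac (- f i) = g i"
            using range(1,2)[OF fb(2) that] by (simp add: frac_unique_iff)
          then show ?thesis by (simp add: N_def F_def)
        qed
        then have "sum g I = sum f I" using Nf by simp
        then show False using f g False by (simp add: box_at_def)
      next
        case 2
        have "g i \<in> \<int>" for i
          using fun_cong[OF 2, of i] unfolding s_def F_def frac_unique_iff by simp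
        then show False using nonint[OF g] k kl by auto
      next
        case 3
        have "f i \<in> \<int>" for i
          using fun_cong[OF 3, of i] unfolding s_def F_def frac_unique_iff by simp
        then show False using nonint[OF f] k by auto
      qed
    qed
    then have "m = l" using height[OF m] \<open>m \<noteq> 0\<close> m uniq False by blast
    define D where "D = F (\<lambda>i. f i + f i)"
    have "D \<in> box a" unfolding D_def
      by (intro F_box coords_add fc) (use fa ga in auto)
    then obtain n where n: "D \<in> box_at a n" by (rule box_height)
    have "n \<noteq> 0"
    proof
      assume "n = 0"
      have "N i = f i" for i
      proof (cases "i \<in> I")
        case True
        have "f i + f i \<in> \<int>" using \<open>n = 0\<close> n box_at_0[of D a i] by (simp add: D_def F_def)
        then have "- f i - f i \<in> \<int>" using Ints_minus by fastforce
        then have "frac (- f i) = f i"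
          using range(1,2)[OF fb(1) True] by (simp add: frac_unique_iff)
        then show ?thesis by (simp add: N_def F_def)
      next
        case False
        then show ?thesis using fc by (simp add: N_def F_def coords_def)
      qed
      then show False using \<open>N \<noteq> f\<close> by blast
    qed
    moreover have "D \<noteq> f"
    proof
      assume "D = f"
      have "f i \<in> \<int>" for i
        using fun_cong[OF \<open>D = f\<close>, of i] unfolding D_def F_def frac_unique_iff by simp
      then show False using nonint[OF f] k by auto
    qed
    ultimately have "n = l" using height[OF n] n uniq False by blast
    have "D i \<le> f i + f i" if "i \<in> I" for i
    proof -
      have "0 \<le> f i + f i" using range[OF fb(1) that] by simp
      then have "0 \<le> \<lfloor>f i + f i\<rfloor>" by simp
      then show ?thesis by (simp add: D_def F_def frac_def)
    qed
    then have "sum D I \<le> sum (\<lambda>i. f i + f i) I" by (rule sum_mono)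
    then have "real l \<le> real (2 * k)"
      using f n \<open>n = l\<close> by (simp only: box_at_def sum.distrib) simp
    then have "l \<le> 2 * k" by linarith
    then show "k + l \<le> CARD('n) + 1 \<and> l \<le> 2 * k" using km \<open>m = l\<close> by simp
  qed
qed

lemma box_at_indicator:
  assumes "a \<in> pos"
  shows "(\<lambda>i. if i \<in> pos \<and> i < a then 1 else 0) \<in> box_at a (card {i \<in> pos. i < a})"
proof -
  have "(\<lambda>i. if i \<in> pos \<and> i < a then 1 else 0) \<in> coords"
    using pos_subset by (intro coords_integral) auto
  moreover have "(\<Sum>i\<in>I. if i \<in> pos \<and> i < a then 1 else 0) = (\<Sum>i\<in>{i \<in> pos. i < a}. 1::real)"
    by (rule sum.mono_neutral_cong_right) (use finite_I pos_subset in auto)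
  ultimately show ?thesis unfolding box_at_def box_def by simp
qed

text \<open>
  The third least element of \<open>pos\<close> would have a \<open>0/1\<close> box point of height \<open>2\<close>.
\<close>

lemma card_pos_le_2:
  assumes "delta_coeff P 2 = 0"
  shows "card pos \<le> 2"
proof (rule ccontr)
  assume *: "\<not> ?thesis"
  define a where "a = Min pos"
  define b where "b = Min (pos - {a})"
  define c where "c = Min (pos - {a, b})"
  have fin: "finite (pos - {a})" "finite (pos - {a, b})" using finite_pos by auto
  have a: "a \<in> pos" unfolding a_def using finite_pos pos_nonempty by simp
  have "pos - {a} \<noteq> {}"
  proof
    assume "pos - {a} = {}"
    then have "pos \<subseteq> {a}" by blast
    then show False using * card_mono[of "{a}" pos] by auto
  qed
  then have b: "b \<in> pos - {a}" unfolding b_def using Min_in[OF fin(1)] by blast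
  have "pos - {a, b} \<noteq> {}"
  proof
    assume "pos - {a, b} = {}"
    then have "pos \<subseteq> {a, b}" by blast
    then show False using * card_mono[of "{a, b}" pos] card_insert_le_m1[of 2 "{b}" a] by auto
  qed
  then have c: "c \<in> pos - {a, b}" unfolding c_def using Min_in[OF fin(2)] by blast
  have ac: "a < c" using Min_le[OF finite_pos, of c] c a_def by fastforce
  have bc: "b < c" using Min_le[OF fin(1), of c] c b_def by fastforce
  have "{i \<in> pos. i < c} = {a, b}"
  proof (intro subset_antisym subsetI)
    fix i assume "i \<in> {i \<in> pos. i < c}"
    then show "i \<in> {a, b}" using Min_le[OF fin(2), of i] c_def by fastforce
  qed (use a b ac bc in auto)
  then have "card {i \<in> pos. i < c} = 2" using b by simp
  then have "delta_coeff P 2 > 0"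
    unfolding delta_coeff_pos_iff using box_at_indicator[of c] c by (intro bexI[of _ c]) auto
  then show False using assms by simp
qed

text \<open>
  If the dependence has two positive and two negative coefficients, a box point \<open>e\<close> of height
  \<open>1\<close> accounts for \<open>\<delta>\<^sub>1\<close>, and besides the origin there is exactly one more box point \<open>g\<close>,
  of height \<open>l\<close>. It omits one of the two positive vertices. Moving \<open>g\<close> along \<open>r\<close> until the other
  positive coordinate vanishes and reducing modulo \<open>1\<close> gives a box point omitting that vertex;
  it is neither \<open>e\<close> nor \<open>g\<close>, so it is \<open>0\<close>. Therefore \<open>g\<close> is integral, hence zero, off the
  support of \<open>r\<close>. At most three coordinates of \<open>g\<close> are left, all below \<open>1\<close>, so the height of
  \<open>g\<close> is less than \<open>3\<close>.
\<close>

lemma quadrilateral_circuit_bound: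
  assumes card_pos: "card pos = 2" and card_neg: "card {i \<in> I. r i < 0} = 2"
    and supp: "\<And>n. 1 < n \<Longrightarrow> n \<le> CARD('n) \<Longrightarrow> n \<noteq> l \<Longrightarrow> delta_coeff P n = 0"
    and one: "delta_coeff P 1 = 1" "delta_coeff P l = 1"
  shows "l \<le> 2"
proof (rule ccontr)
  assume "\<not> l \<le> 2"
  then have l: "3 \<le> l" by simp
  obtain a b where ab: "pos = {a, b}" "a < b"
  proof -
    obtain x y where "pos = {x, y}" "x \<noteq> y" using card_pos by (meson card_2_iff)
    then show ?thesis using that[of x y] that[of y x] by (cases x y rule: linorder_cases) auto
  qed
  have aI: "a \<in> I" "b \<in> I" and ap: "a \<in> pos" "b \<in> pos" using ab pos_subset by auto
  define e :: "nat \<Rightarrow> real" where "e i = (if i \<in> pos \<and> i < b then 1 else 0)" for i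
  have "{i \<in> pos. i < b} = {a}" using ab by auto
  then have e: "e \<in> box_at b 1" using box_at_indicator[OF ap(2)] unfolding e_def by simp
  have ea: "e a = 1" using ab by (simp add: e_def)
  have box_a: "box a = {f \<in> coords. f a = 0 \<and> (\<forall>i\<in>I - {a}. 0 \<le> f i \<and> f i < 1)}"
    using ab by (auto simp: box_def)
  have box_b: "box b = {f \<in> coords. f b = 0 \<and> 0 < f a \<and> f a \<le> 1 \<and>
      (\<forall>i\<in>I - {a, b}. 0 \<le> f i \<and> f i < 1)}"
  proof -
    have "i \<in> pos \<and> i < b \<longleftrightarrow> i = a" for i using ab by auto
    moreover have "I - {b} = insert a (I - {a, b})" using aI ab by auto
    ultimately show ?thesis unfolding box_def by auto
  qed
  have height: "n = 0 \<or> n = 1 \<or> n = l" if "f \<in> box_at c n" "c \<in> pos" for f c n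
  proof (rule ccontr)
    assume "\<not> ?thesis"
    then have "delta_coeff P n = 0" using supp box_height_le[OF that] by auto
    moreover have "delta_coeff P n > 0" unfolding delta_coeff_pos_iff using that by blast
    ultimately show False by simp
  qed
  have height_a: "n = 0 \<or> n = l" if "f \<in> box_at a n" for f n
    using height[OF that ap(1)] box_at_unique(1)[OF one(1) ap(1) _ ap(2) e, of f] that ab by auto
  have height_b: "f = e \<or> n = l" if "f \<in> box_at b n" for f n
  proof -
    have "f \<in> box b" using that by (simp add: box_at_def)
    then have "f a > 0" by (simp add: box_b)
    then have "n \<noteq> 0" using that box_at_0[of f b a] by (metis less_irrefl)
    then show ?thesis
      using height[OF that ap(2)] box_at_unique(2)[OF one(1) ap(2) _ ap(2) e, of f] that by blast
  qed
  \<comment> \<open>A vector that vanishes at both \<open>a\<close> and \<open>b\<close> lies in the box of \<open>a\<close> and, one level higher and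
    with coordinate \<open>a\<close> equal to \<open>1\<close>, in the box of \<open>b\<close>. As no two of the heights
    \<open>0\<close>, \<open>l\<close> are consecutive, only the origin does so.\<close>
  have raise: "f(a := 1) \<in> box_at b (Suc n)" if "f \<in> box_at a n" "f b = 0" for f n
  proof -
    have f: "f \<in> coords" "f a = 0" "\<forall>i\<in>I - {a}. 0 \<le> f i \<and> f i < 1" "sum f I = real n"
      using that(1) by (auto simp: box_at_def box_a)
    have "f(a := 1) \<in> coords" using coords_upd[OF f(1) aI(1), of 1] f(2) by simp
    moreover have "sum (f(a := 1)) I = real (Suc n)" using sum_upd[OF aI(1), of f 1] f by simp
    ultimately show ?thesis using f(3) \<open>f b = 0\<close> ab(2) unfolding box_at_def box_b by auto
  qed
  have lower: "f(a := 0) \<in> box_at a n" if "f \<in> box_at b (Suc n)" "f a = 1" for f n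
  proof -
    have f: "f \<in> coords" "f b = 0" "\<forall>i\<in>I - {a, b}. 0 \<le> f i \<and> f i < 1" "sum f I = real (Suc n)"
      using that(1) by (auto simp: box_at_def box_b)
    have "f(a := 0) \<in> coords" using coords_upd[OF f(1) aI(1), of "-1"] \<open>f a = 1\<close> by simp
    moreover have "sum (f(a := 0)) I = real n"
      using sum_upd[OF aI(1), of f 0] f \<open>f a = 1\<close> by simp
    moreover have "0 \<le> f i \<and> f i < 1" if "i \<in> I - {a}" for i
      using f(2,3) that by (cases "i = b") auto
    ultimately show ?thesis unfolding box_at_def box_a by auto
  qed
  obtain c g where c: "c \<in> pos" and g: "g \<in> box_at c l"
    using one(2) delta_coeff_pos_iff[of l] by auto
  have gc: "g \<in> coords" "g c = 0" using g by (auto simp: box_at_def box_def)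
  have range: "0 \<le> g i \<and> g i < 1" if "i \<in> I" for i
  proof -
    have "g a \<noteq> 1" if "c = b"
    proof
      assume "g a = 1"
      then have "g(a := 0) \<in> box_at a (l - 1)" using lower[of g "l - 1"] g l that by auto
      then show False using height_a l by fastforce
    qed
    note ga = this
    show ?thesis
    proof (cases "c = a")
      case True
      then have "g \<in> box a" using g by (simp add: box_at_def)
      then show ?thesis using \<open>i \<in> I\<close> unfolding box_a by (cases "i = a") auto
    next
      case False
      then have "c = b" using c ab by blast
      then have "g \<in> box b" using g by (simp add: box_at_def)
      then have "g b = 0" "0 < g a" "g a < 1" "\<forall>i\<in>I - {a, b}. 0 \<le> g i \<and> g i < 1"
        using ga[OF \<open>c = b\<close>] unfolding box_b by auto
      then show ?thesis using \<open>i \<in> I\<close> by (cases "i = a"; cases "i = b") auto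
    qed
  qed
  have "\<exists>t. \<forall>i. frac (g i + t * r i) = 0"
  proof (cases "c = a")
    case True
    define t where "t = - g b / r b"
    define f where "f = (\<lambda>i. frac (g i + t * r i))"
    have fc: "f \<in> coords" unfolding f_def by (intro coords_frac coords_add gc coords_dep)
    have fb: "f b = 0" using ap by (simp add: f_def t_def pos_def)
    have fr: "0 \<le> f i \<and> f i < 1" for i by (simp add: f_def frac_lt_1)
    have "f a = 0"
    proof (rule ccontr)
      assume "f a \<noteq> 0"
      then have "f \<in> box b" using fc fb fr by (auto simp: box_b less_le)
      then obtain n where n: "f \<in> box_at b n" by (rule box_height)
      then have "n = l" using height_b[OF n] fr[of a] ea by auto
      then show False using box_at_unique(1)[OF one(2) ap(2) _ ap(1), of f g] n g True ab by auto
    qed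
    then have "f \<in> box a" using fc fr by (auto simp: box_a)
    then obtain n where n: "f \<in> box_at a n" by (rule box_height)
    have "n = 0"
    proof -
      have up: "f(a := 1) \<in> box_at b (Suc n)" by (rule raise[OF n fb])
      have "Suc n = 1 \<or> Suc n = l"
        using height_b[OF up] up e by (auto simp: box_at_def)
      then show ?thesis using height_a[OF n] l by linarith
    qed
    then have "f i = 0" for i using n box_at_0 by blast
    then show ?thesis unfolding f_def by blast
  next
    case False
    then have cb: "c = b" using c ab by auto
    define t where "t = - g a / r a"
    define f where "f = (\<lambda>i. frac (g i + t * r i))"
    have fc: "f \<in> coords" unfolding f_def by (intro coords_frac coords_add gc coords_dep)
    have fa: "f a = 0" using ap by (simp add: f_def t_def pos_def)
    have "f \<in> box a" using fc fa by (auto simp: box_a f_def frac_lt_1)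
    then obtain n where n: "f \<in> box_at a n" by (rule box_height)
    have "n \<noteq> l" using box_at_unique(1)[OF one(2) ap(1) _ ap(2), of f g] n g cb ab by auto
    then have "n = 0" using height_a[OF n] by simp
    then have "f i = 0" for i using n box_at_0 by blast
    then show ?thesis unfolding f_def by blast
  qed
  then obtain t where t: "\<And>i. g i + t * r i \<in> \<int>" by auto
  have zero: "g i = 0" if "i \<in> I" "r i = 0" for i
    using t[of i] that range[OF that(1)] by (intro Ints_unit_interval) auto
  define S where "S = (pos - {c}) \<union> {i \<in> I. r i < 0}"
  have "sum g I = sum g S"
  proof (rule sum.mono_neutral_right[OF finite_I])
    show "S \<subseteq> I" using pos_subset by (auto simp: S_def)
    have "g i = 0" if "i \<in> I - S" for i
      using that zero[of i] gc by (cases "r i" "0::real" rule: linorder_cases) (auto simp: S_def pos_def)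
    then show "\<forall>i\<in>I - S. g i = 0" by blast
  qed
  moreover have "card S = 3"
  proof -
    have "card (pos - {c}) = 1" using card_pos c finite_pos by simp
    then show ?thesis unfolding S_def using card_neg finite_I finite_pos
      by (subst card_Un_disjoint) (auto simp: pos_def)
  qed
  moreover have "sum g S < real (card S)"
  proof (rule sum_less_card)
    show "finite S" "S \<noteq> {}" using \<open>card S = 3\<close> by (auto intro: card_ge_0_finite)
    show "g i < 1" if "i \<in> S" for i using that range pos_subset by (auto simp: S_def)
  qed
  ultimately show False using g l by (simp add: box_at_def)
qed

end

section \<open>Bounds for integral polytopes\<close>

text \<open>
  An affine basis uses all indices but one, say \<open>x\<close>. Writing \<open>v x\<close> in that basis gives the
  dependence, normalised by \<open>r x = 1\<close>; any other one can be cleared at \<open>x\<close> and is then a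
  dependence of the basis.
\<close>

lemma lattice_circuit_exists:
  fixes v :: "nat \<Rightarrow> real ^ 'n"
  assumes I: "finite I" "card I = CARD('n) + 2"
    and lattice: "\<And>i. i \<in> I \<Longrightarrow> v i \<in> integer_points"
    and dim: "aff_dim (convex hull (v ` I)) = int CARD('n)"
  obtains r where "lattice_circuit I v r"
proof -
  obtain B where B: "B \<subseteq> v ` I" "\<not> affine_dependent B" "affine hull (v ` I) = affine hull B"
    using affine_basis_exists[of "v ` I"] by blast
  have finB: "finite B" using B I by (meson finite_imageI finite_subset)
  have cardB: "card B = CARD('n) + 1"
    using aff_dim_unique[of B "v ` I"] B dim by (simp add: aff_dim_convex_hull)
  obtain J where J: "J \<subseteq> I" "inj_on v J" "B = v ` J"
    using B(1) subset_image_inj by metis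
  have finJ: "finite J" using J I finite_subset by blast
  have "card J = CARD('n) + 1" using J cardB card_image by metis
  then have "card (I - J) = 1" using I J finJ by (simp add: card_Diff_subset)
  then obtain x where x: "I - J = {x}" by (meson card_1_singletonE)
  then have IJ: "I = insert x J" "x \<notin> J" using J by auto
  have "v x \<in> affine hull B" unfolding B(3)[symmetric] using IJ by (auto intro: hull_inc)
  then obtain u where u: "sum u B = 1" "(\<Sum>w\<in>B. u w *\<^sub>R w) = v x"
    unfolding affine_hull_finite[OF finB] by auto
  define r where "r i = (if i = x then 1 else if i \<in> J then - u (v i) else 0)" for i
  have uJ: "(\<Sum>i\<in>J. u (v i)) = 1" "(\<Sum>i\<in>J. u (v i) *\<^sub>R v i) = v x"
    using u J by (auto simp: sum.reindex)
  have "sum r J = (\<Sum>i\<in>J. - u (v i))" "(\<Sum>i\<in>J. r i *\<^sub>R v i) = (\<Sum>i\<in>J. - (u (v i) *\<^sub>R v i))"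
    using IJ by (auto intro!: sum.cong simp: r_def)
  then have rJ: "sum r J = - 1" "(\<Sum>i\<in>J. r i *\<^sub>R v i) = - v x"
    using uJ by (simp_all add: sum_negf)
  have "lattice_circuit I v r"
  proof
    show "finite I" "card I = CARD('n) + 2" "\<And>i. i \<in> I \<Longrightarrow> v i \<in> integer_points"
      "aff_dim (convex hull (v ` I)) = int CARD('n)" by fact+
    show "\<And>i. i \<notin> I \<Longrightarrow> r i = 0" "\<exists>i\<in>I. r i \<noteq> 0" using IJ by (auto simp: r_def)
    have "r x = 1" by (simp add: r_def)
    then show "sum r I = 0" "(\<Sum>i\<in>I. r i *\<^sub>R v i) = 0" using rJ IJ finJ by auto
    fix s assume s: "sum s I = 0" "(\<Sum>i\<in>I. s i *\<^sub>R v i) = 0"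
    define s' where "s' i = s i - s x * r i" for i
    have s'x: "s' x = 0" using \<open>r x = 1\<close> by (simp add: s'_def)
    have "sum s' I = 0" "(\<Sum>i\<in>I. s' i *\<^sub>R v i) = 0"
      using s \<open>sum r I = 0\<close> \<open>(\<Sum>i\<in>I. r i *\<^sub>R v i) = 0\<close>
      by (simp_all add: s'_def sum_subtractf scaleR_left_diff_distrib
          flip: sum_distrib_left scaleR_scaleR scaleR_sum_right)
    then have s'J: "sum s' J = 0" "(\<Sum>i\<in>J. s' i *\<^sub>R v i) = 0" using IJ finJ s'x by auto
    define U where "U w = s' (inv_into J v w)" for w
    have UJ: "U (v i) = s' i" if "i \<in> J" for i
      using that J by (simp add: U_def)
    have "sum U B = 0" "(\<Sum>w\<in>B. U w *\<^sub>R w) = 0"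
      using s'J J by (simp_all add: sum.reindex UJ)
    then have "\<forall>w\<in>B. U w = 0"
      using B(2) affine_dependent_explicit_finite[OF finB] by blast
    then have "s' i = 0" if "i \<in> I" for i
      using that UJ[of i] J IJ s'x by auto
    then show "\<exists>c. \<forall>i\<in>I. s i = c * r i" by (auto simp: s'_def)
  qed
  then show thesis by (rule that)
qed

lemma (in lattice_circuit) opposite_circuit: "lattice_circuit I v (\<lambda>i. - r i)"
proof
  show "finite I" "card I = CARD('n) + 2" "\<And>i. i \<in> I \<Longrightarrow> v i \<in> integer_points"
    "aff_dim (convex hull (v ` I)) = int CARD('n)"
    using finite_I card_I lattice full_dim by auto
  show "\<And>i. i \<notin> I \<Longrightarrow> - r i = 0" "\<exists>i\<in>I. - r i \<noteq> 0" using r_outside r_nonzero by auto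
  show "(\<Sum>i\<in>I. - r i) = 0" "(\<Sum>i\<in>I. - r i *\<^sub>R v i) = 0"
    using r_sum r_dep by (simp_all add: sum_negf)
  fix s assume "sum s I = 0" "(\<Sum>i\<in>I. s i *\<^sub>R v i) = 0"
  then obtain c where "\<forall>i\<in>I. s i = c * r i" using dep_unique by blast
  then show "\<exists>c. \<forall>i\<in>I. s i = c * - r i" by (intro exI[of _ "- c"]) auto
qed

lemma integral_polytope_eq_hull_lattice_points:
  fixes P :: "(real ^ 'n) set"
  assumes "integral_polytope P"
  shows "finite (P \<inter> integer_points)" "P = convex hull (P \<inter> integer_points)"
proof -
  have "polytope P" using assms by (simp add: integral_polytope_def)
  then show "finite (P \<inter> integer_points)"
    using finite_bounded_integer_points polytope_imp_bounded by blast
  have "P = convex hull {x. x extreme_point_of P}"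
    using \<open>polytope P\<close> by (intro Krein_Milman_Minkowski polytope_imp_compact polytope_imp_convex)
  also have "\<dots> \<subseteq> convex hull (P \<inter> integer_points)"
    using assms by (intro hull_mono) (auto simp: integral_polytope_def extreme_point_of_def)
  finally show "P = convex hull (P \<inter> integer_points)"
    using \<open>polytope P\<close> polytope_imp_convex
    by (metis Int_lower1 hull_minimal subset_antisym)
qed

lemma delta_coeff_1:
  fixes P :: "(real ^ 'n) set"
  assumes "aff_dim P = int d"
  shows "delta_coeff P 1 = int (card (P \<inter> integer_points)) - int (d + 1)"
proof -
  have *: "fps_nth ((1 - fps_X :: int fps) ^ m) 1 = - int m" for m
  proof (induction m)
    case (Suc m)
    then show ?case by (simp add: left_diff_distrib fps_power_zeroth)
  qed simp
  show ?thesis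
    using *[of "d + 1"] assms
    by (simp add: delta_coeff_def ehrhart_series_def fps_mult_nth_1 fps_power_zeroth
        ehrhart_count_def del: power_Suc)
qed

text \<open>
  Replacing \<open>r\<close> by \<open>- r\<close> exchanges the two triangulations of \<open>P\<close> without changing \<open>P\<close>, so every
  bound on the positive coefficients also holds for the negative ones. If one of the two sign
  classes is a singleton, \<open>P\<close> is a simplex; for \<open>l > 2\<close> the coefficient \<open>\<delta>\<^sub>2 = 0\<close> leaves only
  the case of two coefficients of each sign.
\<close>

lemma (in lattice_circuit) circuit_bound_of_delta_1:
  assumes "2 \<le> l"
    and "\<And>n. 1 < n \<Longrightarrow> n \<le> CARD('n) \<Longrightarrow> n \<noteq> l \<Longrightarrow> delta_coeff P n = 0"
    and "delta_coeff P 1 = 1" "delta_coeff P l = 1"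
  shows "l \<le> 2"
proof (rule ccontr)
  assume l: "\<not> l \<le> 2"
  interpret opp: lattice_circuit I v "\<lambda>i. - r i" by (rule opposite_circuit)
  have opp_pos: "opp.pos = {i \<in> I. r i < 0}" by (simp add: opp.pos_def)
  have d2: "delta_coeff P 2 = 0"
  proof (cases "CARD('n) \<ge> 2")
    case False
    have "box_at a 2 = {}" if "a \<in> pos" for a
      using box_height_le[OF _ that, of _ 2] False by blast
    then show ?thesis unfolding delta_coeff_eq by simp
  qed (use assms l in auto)
  have single: "card pos \<noteq> 1"
  proof
    assume "card pos = 1"
    then obtain a where "pos = {a}" by (meson card_1_singletonE)
    then show False using singleton_circuit_bounds(1)[of a 1 l] assms l by auto
  qed
  have opp_single: "card opp.pos \<noteq> 1"
  proof
    assume "card opp.pos = 1"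
    then obtain a where "opp.pos = {a}" by (meson card_1_singletonE)
    then show False using opp.singleton_circuit_bounds(1)[of a 1 l] assms l by auto
  qed
  have "card pos > 0" "card opp.pos > 0"
    using finite_pos pos_nonempty opp.finite_pos opp.pos_nonempty by (simp_all add: card_gt_0_iff)
  then have "card pos = 2" "card {i \<in> I. r i < 0} = 2"
    using card_pos_le_2[OF d2] opp.card_pos_le_2[OF d2] single opp_single
    unfolding opp_pos by linarith+
  then show False using quadrilateral_circuit_bound[of l] assms l by auto
qed

text \<open>
  The case \<open>k = l\<close> covers both a single and a double nonzero entry. As \<open>\<delta>\<^sub>1\<close> is the number of
  lattice points of \<open>P\<close> minus \<open>CARD('n) + 1\<close>, the polytope is a simplex without further lattice
  points if \<open>k > 1\<close>, and has \<open>CARD('n) + 2\<close> lattice points if \<open>k = 1 < l\<close>. In both cases its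
  lattice points form a circuit, in the first one after a vertex has been doubled.
\<close>

lemma delta_gap_bounds:
  fixes P :: "(real ^ 'n) set"
  assumes P: "integral_polytope P" "aff_dim P = int CARD('n)"
    and k: "1 \<le> k" and kl: "k \<le> l" and l: "l \<le> CARD('n)"
    and supp: "\<And>n. 1 \<le> n \<Longrightarrow> n \<le> CARD('n) \<Longrightarrow> n \<noteq> k \<Longrightarrow> n \<noteq> l \<Longrightarrow> delta_coeff P n = 0"
    and posk: "delta_coeff P k > 0" and posl: "delta_coeff P l > 0"
    and one: "k \<noteq> l \<Longrightarrow> delta_coeff P k = 1 \<and> delta_coeff P l = 1"
  shows "l \<le> 2 * k" "k + l \<le> CARD('n) + 1"
proof -
  let ?Z = "P \<inter> integer_points"
  have Z: "finite ?Z" "P = convex hull ?Z"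
    using integral_polytope_eq_hull_lattice_points[OF P(1)] by auto
  have d1: "delta_coeff P 1 = int (card ?Z) - int (CARD('n) + 1)" by (rule delta_coeff_1[OF P(2)])
  obtain h where h: "bij_betw h {0..<card ?Z} ?Z" using ex_bij_betw_nat_finite[OF Z(1)] by blast
  have "l \<le> 2 * k \<and> k + l \<le> CARD('n) + 1"
  proof (cases "k = 1")
    case True
    show ?thesis
    proof (cases "l = 1")
      case False
      then have delta: "delta_coeff P 1 = 1" "delta_coeff P l = 1" "2 \<le> l"
        using one True kl by auto
      define I where "I = {0..<card ?Z}"
      have hI: "h ` I = ?Z" using h by (simp add: bij_betw_def I_def)
      have "card I = CARD('n) + 2" using d1 delta by (simp add: I_def)
      moreover have "aff_dim (convex hull (h ` I)) = int CARD('n)" using P(2) Z(2) hI by simp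
      moreover have "\<And>i. i \<in> I \<Longrightarrow> h i \<in> integer_points" using hI by blast
      ultimately obtain r where r: "lattice_circuit I h r"
        using lattice_circuit_exists[of I h] by (auto simp: I_def)
      have "l \<le> 2"
        using lattice_circuit.circuit_bound_of_delta_1[OF r, of l] Z(2) hI supp delta True by auto
      then show ?thesis using True l \<open>2 \<le> l\<close> by auto
    qed (use True l in auto)
  next
    case False
    have c: "card ?Z = CARD('n) + 1" using d1 supp[of 1] False k kl l by auto
    \<comment> \<open>The vertex \<open>h 0\<close> is listed a second time, under the index \<open>m\<close>.\<close>
    define m where "m = CARD('n) + 1"
    define w where "w i = (if i = m then h 0 else h i)" for i
    define I where "I = {0..m}"
    have cI: "card I = CARD('n) + 2" by (simp add: I_def m_def)
    have wI: "w ` I = ?Z"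
    proof -
      have "I = insert m {0..<m}" by (auto simp: I_def)
      moreover have "w ` {0..<m} = ?Z"
        using h c by (auto simp: w_def bij_betw_def m_def)
      moreover have "w m \<in> ?Z" using h c unfolding w_def bij_betw_def by auto
      ultimately show ?thesis by auto
    qed
    have "aff_dim (convex hull (w ` I)) = int CARD('n)" using P(2) Z(2) wI by simp
    moreover have "\<And>i. i \<in> I \<Longrightarrow> w i \<in> integer_points" using wI by blast
    ultimately obtain r where "lattice_circuit I w r"
      using lattice_circuit_exists[of I w] cI by (auto simp: I_def)
    then interpret lattice_circuit I w r .
    define s :: "nat \<Rightarrow> real" where "s i = (if i = m then 1 else 0) - (if i = 0 then 1 else 0)" for i
    have "sum s I = 0" by (simp add: s_def sum_subtractf I_def)
    moreover have "(\<Sum>i\<in>I. s i *\<^sub>R w i) = 0"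
    proof -
      have "(\<Sum>i\<in>I. s i *\<^sub>R w i) = (\<Sum>i\<in>{0, m}. s i *\<^sub>R w i)"
        by (rule sum.mono_neutral_right) (auto simp: s_def I_def)
      also have "\<dots> = 0" by (simp add: s_def w_def m_def)
      finally show ?thesis .
    qed
    ultimately obtain c where c: "\<And>i. i \<in> I \<Longrightarrow> s i = c * r i" using dep_unique by blast
    have "m \<noteq> 0" by (simp add: m_def)
    then have "c * r m = 1" "c * r 0 = - 1"
      using c[of m] c[of 0] by (auto simp: s_def I_def)
    have c0: "c * r i = 0" if "i \<in> I" "i \<noteq> m" "i \<noteq> 0" for i
      using c[of i] that by (simp add: s_def)
    have "c \<noteq> 0" using \<open>c * r m = 1\<close> by auto
    have rm: "r m = 1 / c" "r 0 = - 1 / c"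
      using \<open>c * r m = 1\<close> \<open>c * r 0 = - 1\<close> \<open>c \<noteq> 0\<close> by (auto simp: field_simps)
    have ri: "r i = 0" if "i \<in> I" "i \<noteq> m" "i \<noteq> 0" for i using c0[OF that] \<open>c \<noteq> 0\<close> by simp
    have "pos = {if c > 0 then m else 0}"
    proof (rule set_eqI)
      fix i show "i \<in> pos \<longleftrightarrow> i \<in> {if c > 0 then m else 0}"
        unfolding pos_def using rm ri[of i] \<open>c \<noteq> 0\<close> \<open>m \<noteq> 0\<close>
        by (cases "i = m"; cases "i = 0") (auto simp: I_def zero_less_divide_iff divide_less_0_iff)
    qed
    from singleton_circuit_bounds[OF this k kl] show ?thesis
      using supp posk posl one Z(2) wI by auto
  qed
  then show "l \<le> 2 * k" "k + l \<le> CARD('n) + 1" by auto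
qed

section \<open>Simplices with a cyclic box group\<close>

lemma frac_nat_divide: "frac (real a / real m) = real (a mod m) / real m"
proof (cases "m = 0")
  case False
  have "real a = real (a div m) * real m + real (a mod m)"
    by (metis div_mult_mod_eq of_nat_add of_nat_mult)
  then have "real a / real m - real (a mod m) / real m = real (a div m)"
    using False by (simp add: field_simps)
  then show ?thesis using False by (simp add: frac_unique_iff)
qed simp

text \<open>
  The vertices are \<open>0\<close>, all unit vectors but one, and one vector with entry \<open>m\<close> in the remaining
  direction and entries \<open>- c i\<close> in the others. Its box points are the multiples modulo \<open>1\<close> of
  \<open>(c 0 / m, \<dots>, c d / m)\<close>, where \<open>c\<close> takes the value \<open>1\<close> on \<open>p\<close> indices, \<open>2\<close> on \<open>q\<close> indices and
  \<open>0\<close> elsewhere. The condition \<open>1 \<le> p\<close> provides the value \<open>c 0 = 1\<close> at the special vertex, and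
  \<open>m dvd p + 2 * q\<close> makes the generator a lattice point; its multiple by \<open>j\<close> has height
  \<open>(p * (j mod m) + q * (2 * j mod m)) / m\<close>.
\<close>

lemma simplex_with_cyclic_boxes:
  fixes m p q :: nat
  assumes p: "1 \<le> p" and pq: "p + q \<le> CARD('n) + 1" and m: "1 \<le> m" "m dvd p + 2 * q"
  obtains P :: "(real ^ 'n) set"
  where "integral_polytope P" "aff_dim P = int CARD('n)"
    "\<And>n. delta_coeff P n = (\<Sum>j<m. of_bool (p * (j mod m) + q * (2 * j mod m) = m * n))"
proof -
  define D where "D = CARD('n)"
  have D: "1 \<le> D" by (simp add: D_def Suc_le_eq)
  define I where "I = {..D + 1}"
  obtain k :: "'n \<Rightarrow> nat" where k: "bij_betw k UNIV {0..<D}"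
    using ex_bij_betw_finite_nat[of "UNIV :: 'n set"] by (auto simp: D_def)
  have kD: "k j < D" for j using k by (auto simp: bij_betw_def)
  have k_onto: "\<exists>j. k j = i" if "i < D" for i
    using k that by (metis atLeast0LessThan bij_betw_def imageE lessThan_iff)
  obtain j0 where j0: "k j0 = 0" using k_onto[of 0] D by auto
  define c :: "nat \<Rightarrow> nat" where "c i = (if i < p then 1 else if i < p + q then 2 else 0)" for i
  have c0: "c 0 = 1" using p by (simp add: c_def)
  \<comment> \<open>The indices \<open>D\<close> and \<open>D + 1\<close> exceed every \<open>k j\<close> and therefore both stand for the origin.\<close>
  define v :: "nat \<Rightarrow> real ^ 'n" where
    "v i = (\<chi> j. if i = 0 then (if k j = 0 then real m else - real (c (k j)))
      else if i = k j then 1 else 0)" for i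
  have comb_nth: "(\<Sum>i\<in>I. f i *\<^sub>R v i) $ j
      = (if k j = 0 then real m * f 0 else f (k j) - real (c (k j)) * f 0)" for f j
  proof -
    have "(\<Sum>i\<in>I. f i *\<^sub>R v i) $ j = (\<Sum>i\<in>I. f i * v i $ j)" by simp
    also have "\<dots> = (\<Sum>i\<in>{0, k j}. f i * v i $ j)"
      using kD[of j] by (intro sum.mono_neutral_right) (auto simp: I_def v_def)
    also have "\<dots> = (if k j = 0 then real m * f 0 else f (k j) - real (c (k j)) * f 0)"
      by (simp add: v_def)
    finally show ?thesis .
  qed
  have full: "affine hull (v ` I) = UNIV"
  proof -
    have "v D = 0" using D kD by (auto simp: v_def vec_eq_iff)
    then have "0 \<in> affine hull (v ` I)" by (auto simp: I_def intro!: hull_inc image_eqI[of _ _ D])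
    then have "affine hull (v ` I) = span (v ` I)" by (rule affine_hull_span_0)
    moreover have "y \<in> span (v ` I)" for y
    proof -
      have kinj: "k i = k j \<Longrightarrow> i = j" for i j using k by (auto simp: bij_betw_def inj_on_def)
      define f0 where "f0 = y $ j0 / real m"
      define f where "f i = (if i = 0 then f0 else y $ (inv k i) + real (c i) * f0)" for i
      have invk: "inv k (k j) = j" for j using kinj by (simp add: inj_def)
      have "(\<Sum>i\<in>I. f i *\<^sub>R v i) $ j = y $ j" for j
        unfolding comb_nth using m j0 kinj[of j j0] by (auto simp: f_def f0_def invk)
      then have "y = (\<Sum>i\<in>I. f i *\<^sub>R v i)" by (simp add: vec_eq_iff)
      also have "\<dots> \<in> span (v ` I)" by (intro span_sum span_scale span_base) auto
      finally show ?thesis .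
    qed
    ultimately show ?thesis by auto
  qed
  have dim: "aff_dim (convex hull (v ` I)) = int CARD('n)"
    using full aff_dim_eq_full[of "v ` I"] by (simp add: aff_dim_convex_hull)
  have lat: "v i \<in> integer_points" for i
    by (auto simp: v_def integer_points_def)
  define r :: "nat \<Rightarrow> real" where
    "r i = (if i = D + 1 then 1 else 0) - (if i = D then 1 else 0)" for i
  interpret lattice_circuit I v r
  proof
    show "finite I" "card I = CARD('n) + 2" by (simp_all add: I_def D_def)
    show "\<And>i. i \<notin> I \<Longrightarrow> r i = 0" "\<exists>i\<in>I. r i \<noteq> 0" "sum r I = 0"
      by (auto simp: r_def I_def sum_subtractf)
    show "(\<Sum>i\<in>I. r i *\<^sub>R v i) = 0"
    proof -
      have "r 0 = 0" "r (k j) = 0" for j using kD[of j] D by (auto simp: r_def)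
      then have "(\<Sum>i\<in>I. r i *\<^sub>R v i) $ j = 0" for j unfolding comb_nth by simp
      then show ?thesis by (simp add: vec_eq_iff)
    qed
    fix s assume s: "sum s I = 0" "(\<Sum>i\<in>I. s i *\<^sub>R v i) = 0"
    then have comp: "(if k j = 0 then real m * s 0 else s (k j) - real (c (k j)) * s 0) = 0" for j
      using comb_nth[of s j] by simp
    have "s 0 = 0" using comp[of j0] j0 m by simp
    then have sD: "s i = 0" if "i < D" for i
      using k_onto[OF that] comp by (metis diff_zero mult_zero_right)
    have "sum s I = sum s {D, D + 1}"
      by (rule sum.mono_neutral_right) (auto simp: I_def sD)
    then have "s D = - s (D + 1)" using s by simp
    then have "s i = s (D + 1) * r i" if "i \<in> I" for i
      using sD[of i] that by (auto simp: r_def I_def)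
    then show "\<exists>c. \<forall>i\<in>I. s i = c * r i" by blast
  qed (use lat dim in auto)
  have pos: "pos = {D + 1}" unfolding pos_def by (auto simp: r_def I_def)
  have box_D: "box (D + 1) = {f \<in> coords. f (D + 1) = 0 \<and> (\<forall>i\<le>D. 0 \<le> f i \<and> f i < 1)}"
  proof -
    have "I - {D + 1} = {..D}" by (auto simp: I_def)
    then show ?thesis unfolding box_def pos by auto
  qed
  define w :: "nat \<Rightarrow> nat \<Rightarrow> real" where
    "w j i = (if i \<le> D then real (j * c i) / real m else 0)" for j i
  have sum_c: "(\<Sum>i\<le>D. \<phi> (c i)) = real p * \<phi> 1 + real q * \<phi> 2 + real (D + 1 - p - q) * \<phi> 0"
    for \<phi> :: "nat \<Rightarrow> real"
  proof -
    have "(\<Sum>i\<le>D. \<phi> (c i)) = (\<Sum>i\<in>{0..<D + 1}. \<phi> (c i))"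
      by (simp add: atLeast0LessThan lessThan_Suc_atMost)
    also have "\<dots> = (\<Sum>i\<in>{0..<p}. \<phi> (c i)) + (\<Sum>i\<in>{p..<p + q}. \<phi> (c i))
        + (\<Sum>i\<in>{p + q..<D + 1}. \<phi> (c i))"
      using pq sum.atLeastLessThan_concat[of 0 p "p + q" "\<lambda>i. \<phi> (c i)"]
        sum.atLeastLessThan_concat[of 0 "p + q" "D + 1" "\<lambda>i. \<phi> (c i)"]
      by (simp add: D_def)
    also have "(\<Sum>i\<in>{0..<p}. \<phi> (c i)) = (\<Sum>i\<in>{0..<p}. \<phi> 1)"
      by (rule sum.cong) (auto simp: c_def)
    also have "(\<Sum>i\<in>{p..<p + q}. \<phi> (c i)) = (\<Sum>i\<in>{p..<p + q}. \<phi> 2)"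
      by (rule sum.cong) (auto simp: c_def)
    also have "(\<Sum>i\<in>{p + q..<D + 1}. \<phi> (c i)) = (\<Sum>i\<in>{p + q..<D + 1}. \<phi> 0)"
      by (rule sum.cong) (auto simp: c_def)
    finally show ?thesis by simp
  qed
  have sum_I: "sum f I = sum f {..D} + f (D + 1)" for f :: "nat \<Rightarrow> real"
    by (simp add: I_def)
  have w_coords: "w j \<in> coords" for j
  proof -
    obtain t where t: "p + 2 * q = m * t" using m(2) by (auto simp: dvd_def)
    have "sum (w j) I = (\<Sum>i\<le>D. real j / real m * real (c i))"
      unfolding sum_I by (simp add: w_def)
    also have "\<dots> = real j / real m * real (p + 2 * q)"
      unfolding sum_distrib_left[symmetric] using sum_c[of real] by simp
    also have "\<dots> = real (j * t)" unfolding t using m by simp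
    finally have "sum (w j) I \<in> \<int>" by simp
    moreover have "comb (w j) \<in> integer_points"
      unfolding integer_points_def comb_def
    proof (intro CollectI allI)
      fix i show "(\<Sum>i\<in>I. w j i *\<^sub>R v i) $ i \<in> \<int>"
        unfolding comb_nth using kD[of i] m c0 by (simp add: w_def)
    qed
    ultimately show ?thesis unfolding coords_def by (auto simp: w_def I_def)
  qed
  define F where "F j = (\<lambda>i. frac (w j i))" for j
  have height: "sum (F j) I = real (p * (j mod m) + q * (2 * j mod m)) / real m" for j
  proof -
    have "sum (F j) I = (\<Sum>i\<le>D. real (j * c i mod m) / real m)"
      unfolding sum_I F_def w_def by (simp add: frac_nat_divide del: of_nat_mult)
    also have "\<dots> = real (p * (j mod m) + q * (2 * j mod m)) / real m"
      using sum_c[of "\<lambda>x. real (j * x mod m) / real m"]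
      by (simp add: add_divide_distrib mult.commute)
    finally show ?thesis .
  qed
  have bij: "bij_betw F {..<m} (box (D + 1))"
  proof (rule bij_betwI')
    fix i j assume ij: "i \<in> {..<m}" "j \<in> {..<m}"
    show "F i = F j \<longleftrightarrow> i = j"
    proof
      assume "F i = F j"
      then have "F i 0 = F j 0" by simp
      then show "i = j" using ij m
        by (simp add: F_def w_def c0 frac_nat_divide)
    qed simp
  next
    fix j assume "j \<in> {..<m}"
    have "F j \<in> coords" unfolding F_def by (rule coords_frac[OF w_coords])
    then show "F j \<in> box (D + 1)" unfolding box_D by (simp add: F_def frac_lt_1, simp add: w_def)
  next
    fix f assume "f \<in> box (D + 1)"
    then have f: "f \<in> coords" "f (D + 1) = 0" "\<And>i. i \<le> D \<Longrightarrow> 0 \<le> f i \<and> f i < 1"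
      unfolding box_D by auto
    have comp: "(if k j = 0 then real m * f 0 else f (k j) - real (c (k j)) * f 0) \<in> \<int>" for j
      using f(1) unfolding comb_nth[symmetric] coords_def comb_def integer_points_def by blast
    have "real m * f 0 \<in> \<int>" using comp[of j0] j0 by simp
    moreover have "0 \<le> real m * f 0" "real m * f 0 < real m" using f(3)[of 0] m by auto
    ultimately obtain j where j: "real m * f 0 = real j" "j < m"
      by (metis Ints_cases nonneg_int_cases of_int_0_le_iff of_int_of_nat_eq of_nat_less_iff)
    have f0: "f 0 = real j / real m" using j m by (simp add: field_simps)
    have diff: "(\<lambda>i. f i - w j i) \<in> coords" by (intro coords_diff f w_coords)
    have int: "f i - w j i \<in> \<int>" if "i < D" for i
    proof (cases "i = 0")
      case True
      then show ?thesis by (simp add: w_def c0 f0)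
    next
      case False
      obtain l where "k l = i" using k_onto[of i] \<open>i < D\<close> by blast
      then show ?thesis using comp[of l] False that by (simp add: w_def f0 mult.commute)
    qed
    \<comment> \<open>No coordinate of the ambient space controls the index \<open>D\<close> of the origin; it is determined
      modulo \<open>1\<close> by the height.\<close>
    have "sum (\<lambda>i. f i - w j i) I = (\<Sum>i<D. f i - w j i) + (f D - w j D)"
      unfolding sum_I using f(2) by (simp add: w_def lessThan_Suc_atMost[symmetric])
    moreover have "(\<Sum>i<D. f i - w j i) \<in> \<int>" using int by (intro Ints_sum) auto
    moreover have "sum (\<lambda>i. f i - w j i) I \<in> \<int>" using diff by (simp add: coords_def)
    ultimately have "f D - w j D \<in> \<int>" by (metis Ints_diff add_diff_cancel_left')
    then have int': "f i - w j i \<in> \<int>" if "i \<le> D" for i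
      using int[of i] that by (cases "i = D") auto
    have "f i = F j i" for i
    proof (cases "i \<le> D")
      case True
      then have "w j i - f i \<in> \<int>" using int'[OF True] by (metis Ints_minus minus_diff_eq)
      then have "frac (w j i) = f i" using f(3)[OF True] by (simp add: frac_unique_iff)
      then show ?thesis by (simp add: F_def)
    next
      case False
      then have "f i = 0" using f(1,2) unfolding coords_def by (cases "i = D + 1") (auto simp: I_def)
      then show ?thesis using False by (simp add: F_def w_def)
    qed
    then show "\<exists>j\<in>{..<m}. f = F j" using j by blast
  qed
  have "delta_coeff P n = (\<Sum>j<m. of_bool (p * (j mod m) + q * (2 * j mod m) = m * n))" for n
  proof -
    let ?J = "{j \<in> {..<m}. p * (j mod m) + q * (2 * j mod m) = m * n}"
    have hn: "sum (F j) I = real n \<longleftrightarrow> p * (j mod m) + q * (2 * j mod m) = m * n" for j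
    proof -
      have "sum (F j) I = real n
          \<longleftrightarrow> real (p * (j mod m) + q * (2 * j mod m)) = real (m * n)"
        unfolding height using m by (simp add: divide_eq_eq mult.commute)
      then show ?thesis unfolding of_nat_eq_iff .
    qed
    have "box_at (D + 1) n = F ` ?J"
    proof (intro subset_antisym subsetI)
      fix f assume f: "f \<in> box_at (D + 1) n"
      then obtain j where "j < m" "f = F j"
        using bij unfolding box_at_def bij_betw_def by auto
      then show "f \<in> F ` ?J" using f hn by (auto simp: box_at_def)
    next
      fix f assume "f \<in> F ` ?J"
      then show "f \<in> box_at (D + 1) n"
        using hn bij unfolding box_at_def bij_betw_def by auto
    qed
    moreover have "inj_on F ?J" using bij unfolding bij_betw_def by (auto intro: inj_on_subset)
    ultimately have "card (box_at (D + 1) n) = card ?J" by (simp add: card_image)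
    moreover have "int (card ?J) = (\<Sum>j<m. of_bool (p * (j mod m) + q * (2 * j mod m) = m * n))"
    proof -
      have "(\<Sum>j<m. of_bool (p * (j mod m) + q * (2 * j mod m) = m * n)) = (\<Sum>j\<in>?J. 1::int)"
        by (rule sum.mono_neutral_cong_right) auto
      then show ?thesis by (simp only: card_eq_sum of_nat_sum of_nat_1)
    qed
    ultimately show ?thesis unfolding delta_coeff_eq pos by simp
  qed
  moreover have "integral_polytope P"
    unfolding integral_polytope_def
    using finite_I lat extreme_point_of_convex_hull by (fastforce intro: polytope_convex_hull)
  ultimately show thesis using dim that by blast
qed

section \<open>Sequences with small sum\<close>

lemma small_sum_cases [consumes 3, case_names zero one two]:
  fixes f :: "'i \<Rightarrow> int"
  assumes A: "finite A" and nonneg: "\<forall>i\<in>A. 0 \<le> f i" and small: "sum f A \<le> 2"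
  obtains (zero) "\<forall>i\<in>A. f i = 0"
    | (one) k where "k \<in> A" "\<And>i. i \<in> A \<Longrightarrow> f i = of_bool (i = k)"
    | (two) k l where "k \<in> A" "l \<in> A" "\<And>i. i \<in> A \<Longrightarrow> f i = of_bool (i = k) + of_bool (i = l)"
proof -
  have dec: "(\<forall>i\<in>A. 0 \<le> g i - of_bool (i = k)) \<and>
      sum (\<lambda>i. g i - of_bool (i = k)) A = sum g A - 1"
    if "k \<in> A" "g k \<noteq> 0" "\<And>i. i \<in> A \<Longrightarrow> 0 \<le> g i" for k and g :: "'i \<Rightarrow> int"
  proof
    have "1 \<le> g k" using that(2) that(3)[OF that(1)] by linarith
    then show "\<forall>i\<in>A. 0 \<le> g i - of_bool (i = k)" using that by (auto simp: of_bool_def)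
    show "sum (\<lambda>i. g i - of_bool (i = k)) A = sum g A - 1"
      using that A by (simp add: sum_subtractf of_bool_def)
  qed
  show thesis
  proof (cases "\<forall>i\<in>A. f i = 0")
    case False
    then obtain k where k: "k \<in> A" "f k \<noteq> 0" by blast
    define g where "g i = f i - of_bool (i = k)" for i
    have g: "\<And>i. i \<in> A \<Longrightarrow> 0 \<le> g i" "sum g A \<le> 1"
      using dec[of k f, OF k bspec[OF nonneg]] small by (auto simp: g_def)
    show thesis
    proof (cases "\<forall>i\<in>A. g i = 0")
      case True
      then show thesis using one[of k] k by (simp add: g_def)
    next
      case False
      then obtain l where l: "l \<in> A" "g l \<noteq> 0" by blast
      define h where "h i = g i - of_bool (i = l)" for i
      have h: "\<And>i. i \<in> A \<Longrightarrow> 0 \<le> h i" "sum h A \<le> 0"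
        using dec[of l g, OF l g(1)] g(2) by (auto simp: h_def)
      then have "sum h A = 0" using sum_nonneg[of A h] by force
      then have "\<forall>i\<in>A. h i = 0" using h(1) sum_nonneg_eq_0_iff[OF A, of h] by blast
      then have "f i = of_bool (i = k) + of_bool (i = l)" if "i \<in> A" for i
        using that by (force simp: h_def g_def)
      then show thesis using two[of k l] k l by blast
    qed
  qed (use zero in blast)
qed

lemma sum_interval_of_bool_eq: "(\<Sum>j=m..n. of_bool (j = a)) = (of_bool (m \<le> a \<and> a \<le> n) :: int)"
  for a m n :: nat
  by (simp add: of_bool_def)

lemma inequalities_iff_one:
  fixes \<delta> :: "nat \<Rightarrow> int"
  assumes k: "1 \<le> k" "k < d"
    and \<delta>: "\<And>i. i \<le> d \<Longrightarrow> \<delta> i = of_bool (i = 0) + of_bool (i = k)"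
  shows "(\<forall>i \<le> k div 2. (\<Sum>j=0..i. \<delta> j) \<le> (\<Sum>j=0..i. \<delta> (k - j))) \<and>
      (\<forall>i. 1 \<le> i \<and> i \<le> (d - 1) div 2 \<longrightarrow>
         (\<Sum>j=1..i. \<delta> (d - j)) \<le> (\<Sum>j=2..i + 1. \<delta> j))
    \<longleftrightarrow> 2 * k \<le> d + 1"
proof -
  have s1: "(\<Sum>j=0..i. \<delta> j) = 1" if "i \<le> k div 2" for i
  proof -
    have "(\<Sum>j=0..i. \<delta> j) = (\<Sum>j=0..i. of_bool (j = 0) + of_bool (j = k))"
      using that k by (intro sum.cong) (auto simp: \<delta>)
    then show ?thesis using that k by (simp add: sum.distrib sum_interval_of_bool_eq)
  qed
  have s2: "(\<Sum>j=0..i. \<delta> (k - j)) = 1" if "i \<le> k div 2" for i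
  proof -
    have "(\<Sum>j=0..i. \<delta> (k - j)) = (\<Sum>j=0..i. of_bool (j = 0))"
      using that k by (intro sum.cong) (auto simp: \<delta> of_bool_def)
    then show ?thesis by (simp add: sum_interval_of_bool_eq)
  qed
  have s3: "(\<Sum>j=1..i. \<delta> (d - j)) = of_bool (d - k \<le> i)" if "i \<le> (d - 1) div 2" for i
  proof -
    have "(\<Sum>j=1..i. \<delta> (d - j)) = (\<Sum>j=1..i. of_bool (j = d - k))"
      using that k by (intro sum.cong) (auto simp: \<delta> of_bool_def)
    then show ?thesis using k by (simp only: sum_interval_of_bool_eq) (auto simp: of_bool_def)
  qed
  have s4: "(\<Sum>j=2..i + 1. \<delta> j) = of_bool (2 \<le> k \<and> k \<le> i + 1)" if "1 \<le> i" "i \<le> (d - 1) div 2" for i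
  proof -
    have "(\<Sum>j=2..i + 1. \<delta> j) = (\<Sum>j=2..i + 1. of_bool (j = k))"
      using that k by (intro sum.cong) (auto simp: \<delta> of_bool_def)
    then show ?thesis by (simp only: sum_interval_of_bool_eq)
  qed
  show ?thesis
  proof
    assume *: "(\<forall>i \<le> k div 2. (\<Sum>j=0..i. \<delta> j) \<le> (\<Sum>j=0..i. \<delta> (k - j))) \<and>
      (\<forall>i. 1 \<le> i \<and> i \<le> (d - 1) div 2 \<longrightarrow>
         (\<Sum>j=1..i. \<delta> (d - j)) \<le> (\<Sum>j=2..i + 1. \<delta> j))"
    show "2 * k \<le> d + 1"
    proof (rule ccontr)
      assume "\<not> ?thesis"
      then have i: "1 \<le> d - k" "d - k \<le> (d - 1) div 2" and "\<not> k \<le> d - k + 1"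
        using k by auto
      with * have "(\<Sum>j=1..d - k. \<delta> (d - j)) \<le> (\<Sum>j=2..(d - k) + 1. \<delta> j)" by blast
      then show False using s3[OF i(2)] s4[OF i] \<open>\<not> k \<le> d - k + 1\<close> by simp
    qed
  next
    assume "2 * k \<le> d + 1"
    then have "(of_bool (d - k \<le> i) :: int) \<le> of_bool (2 \<le> k \<and> k \<le> i + 1)"
      if "1 \<le> i" "i \<le> (d - 1) div 2" for i
      using k that by (auto simp: of_bool_def)
    then show "(\<forall>i \<le> k div 2. (\<Sum>j=0..i. \<delta> j) \<le> (\<Sum>j=0..i. \<delta> (k - j))) \<and>
      (\<forall>i. 1 \<le> i \<and> i \<le> (d - 1) div 2 \<longrightarrow>
         (\<Sum>j=1..i. \<delta> (d - j)) \<le> (\<Sum>j=2..i + 1. \<delta> j))"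
      using s1 s2 s3 s4 by auto
  qed
qed

text \<open>
  The decisive indices are \<open>i = a\<close> in the first family, when \<open>a \<le> b div 2\<close>, and \<open>i = d - b\<close> in
  the second. The comparison of \<open>\<delta> 1\<close> with \<open>\<delta> d\<close> excludes \<open>b = d\<close> unless \<open>a = 1\<close>, where the
  second family does not see the entry at \<open>d\<close>.
\<close>

lemma inequalities_iff_two:
  fixes \<delta> :: "nat \<Rightarrow> int"
  assumes ab: "1 \<le> a" "a \<le> b" "b \<le> d" and d: "3 \<le> d" and ends: "\<delta> d \<le> \<delta> 1"
    and \<delta>: "\<And>i. i \<le> d \<Longrightarrow> \<delta> i = of_bool (i = 0) + (of_bool (i = a) + of_bool (i = b))"
  shows "(\<forall>i \<le> b div 2. (\<Sum>j=0..i. \<delta> j) \<le> (\<Sum>j=0..i. \<delta> (b - j))) \<and>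
      (\<forall>i. 1 \<le> i \<and> i \<le> (d - 1) div 2 \<longrightarrow>
         (\<Sum>j=1..i. \<delta> (d - j)) \<le> (\<Sum>j=2..i + 1. \<delta> j))
    \<longleftrightarrow> b \<le> 2 * a \<and> a + b \<le> d + 1"
proof -
  have bd: "b = d \<Longrightarrow> a = 1" using ends \<delta>[of d] \<delta>[of 1] ab d by (auto simp: of_bool_def split: if_splits)
  have s1: "(\<Sum>j=0..i. \<delta> j) = 1 + of_bool (a \<le> i)" if "i \<le> b div 2" for i
  proof -
    have "(\<Sum>j=0..i. \<delta> j) = (\<Sum>j=0..i. of_bool (j = 0) + (of_bool (j = a) + of_bool (j = b)))"
      using that ab by (intro sum.cong) (auto simp: \<delta>)
    then show ?thesis using that ab by (simp add: sum.distrib sum_interval_of_bool_eq)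
  qed
  have s2: "(\<Sum>j=0..i. \<delta> (b - j)) = 1 + of_bool (b - a \<le> i)" if "i \<le> b div 2" for i
  proof -
    have "(\<Sum>j=0..i. \<delta> (b - j)) = (\<Sum>j=0..i. of_bool (j = 0) + of_bool (j = b - a))"
      using that ab by (intro sum.cong) (auto simp: \<delta> of_bool_def)
    then show ?thesis by (simp add: sum.distrib sum_interval_of_bool_eq)
  qed
  have s3: "(\<Sum>j=1..i. \<delta> (d - j))
      = of_bool (1 \<le> d - a \<and> d - a \<le> i) + of_bool (1 \<le> d - b \<and> d - b \<le> i)"
    if "i \<le> (d - 1) div 2" for i
  proof -
    have "(\<Sum>j=1..i. \<delta> (d - j)) = (\<Sum>j=1..i. of_bool (j = d - a) + of_bool (j = d - b))"
      using that ab by (intro sum.cong) (auto simp: \<delta> of_bool_def)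
    then show ?thesis by (simp only: sum.distrib sum_interval_of_bool_eq)
  qed
  have s4: "(\<Sum>j=2..i + 1. \<delta> j) = of_bool (2 \<le> a \<and> a \<le> i + 1) + of_bool (2 \<le> b \<and> b \<le> i + 1)"
    if "1 \<le> i" "i \<le> (d - 1) div 2" for i
  proof -
    have "(\<Sum>j=2..i + 1. \<delta> j) = (\<Sum>j=2..i + 1. of_bool (j = a) + of_bool (j = b))"
      using that ab by (intro sum.cong) (auto simp: \<delta> of_bool_def)
    then show ?thesis by (simp only: sum.distrib sum_interval_of_bool_eq)
  qed
  show ?thesis
  proof
    assume *: "(\<forall>i \<le> b div 2. (\<Sum>j=0..i. \<delta> j) \<le> (\<Sum>j=0..i. \<delta> (b - j))) \<and>
      (\<forall>i. 1 \<le> i \<and> i \<le> (d - 1) div 2 \<longrightarrow>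
         (\<Sum>j=1..i. \<delta> (d - j)) \<le> (\<Sum>j=2..i + 1. \<delta> j))"
    have "b \<le> 2 * a"
    proof (rule ccontr)
      assume "\<not> ?thesis"
      then have "a \<le> b div 2" "\<not> b - a \<le> a" by simp_all
      with * have "(\<Sum>j=0..a. \<delta> j) \<le> (\<Sum>j=0..a. \<delta> (b - j))" by blast
      then show False using s1[OF \<open>a \<le> b div 2\<close>] s2[OF \<open>a \<le> b div 2\<close>] \<open>\<not> b - a \<le> a\<close> by simp
    qed
    moreover have "a + b \<le> d + 1"
    proof (rule ccontr)
      assume "\<not> ?thesis"
      then have i: "1 \<le> d - b" "d - b \<le> (d - 1) div 2" using ab bd by fastforce+
      with * have "(\<Sum>j=1..d - b. \<delta> (d - j)) \<le> (\<Sum>j=2..(d - b) + 1. \<delta> j)" by blast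
      then show False using s3[OF i(2)] s4[OF i] i(1) ab \<open>\<not> a + b \<le> d + 1\<close>
        by (auto simp: of_bool_def split: if_splits)
    qed
    ultimately show "b \<le> 2 * a \<and> a + b \<le> d + 1" ..
  next
    assume *: "b \<le> 2 * a \<and> a + b \<le> d + 1"
    have "(of_bool (a \<le> i) :: int) \<le> of_bool (b - a \<le> i)" if "i \<le> b div 2" for i
      using * that by (auto simp: of_bool_def)
    moreover have "(of_bool (1 \<le> d - a \<and> d - a \<le> i) + of_bool (1 \<le> d - b \<and> d - b \<le> i) :: int)
        \<le> of_bool (2 \<le> a \<and> a \<le> i + 1) + of_bool (2 \<le> b \<and> b \<le> i + 1)"
      if "1 \<le> i" "i \<le> (d - 1) div 2" for i
      using * ab d that by (auto simp: of_bool_def)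
    ultimately show "(\<forall>i \<le> b div 2. (\<Sum>j=0..i. \<delta> j) \<le> (\<Sum>j=0..i. \<delta> (b - j))) \<and>
      (\<forall>i. 1 \<le> i \<and> i \<le> (d - 1) div 2 \<longrightarrow>
         (\<Sum>j=1..i. \<delta> (d - j)) \<le> (\<Sum>j=2..i + 1. \<delta> j))"
      using s1 s2 s3 s4 by auto
  qed
qed

theorem theorem0p1:
  fixes d s :: nat and \<delta> :: "nat \<Rightarrow> int"
  assumes "CARD('n::finite) = d"
    and "d \<ge> 3"
    and "\<And>i. i \<le> d \<Longrightarrow> \<delta> i \<ge> 0"
    and "\<delta> 0 = 1"
    and "\<delta> 1 \<ge> \<delta> d"
    and "(\<Sum>i=0..d. \<delta> i) \<le> 3"
    and "s = Max {i. i \<le> d \<and> \<delta> i \<noteq> 0}"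
  shows "(\<exists>P :: (real ^ 'n) set.
            integral_polytope P \<and> aff_dim P = int d \<and> delta_vector P = map \<delta> [0..<d + 1])
    \<longleftrightarrow>
      (\<forall>i \<le> s div 2. (\<Sum>j=0..i. \<delta> j) \<le> (\<Sum>j=0..i. \<delta> (s - j))) \<and>
      (\<forall>i. 1 \<le> i \<and> i \<le> (d - 1) div 2 \<longrightarrow>
         (\<Sum>j=1..i. \<delta> (d - j)) \<le> (\<Sum>j=2..i + 1. \<delta> j))"
    (is "?ex \<longleftrightarrow> ?ineq")
proof -
  have vec: "delta_vector P = map \<delta> [0..<d + 1] \<longleftrightarrow> (\<forall>i\<le>d. delta_coeff P i = \<delta> i)"
    if "aff_dim P = int d" for P :: "(real ^ 'n) set"
    using that by (auto simp: delta_vector_def less_Suc_eq_le)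
  have realize: ?ex if "integral_polytope P" "aff_dim P = int CARD('n)" "\<And>i. i \<le> d \<Longrightarrow> delta_coeff P i = \<delta> i"
    for P :: "(real ^ 'n) set"
    using that vec[of P] assms(1) by auto
  have realized: "\<exists>P :: (real ^ 'n) set. integral_polytope P \<and> aff_dim P = int CARD('n) \<and>
      (\<forall>i\<le>d. delta_coeff P i = \<delta> i)" if ?ex
    using that vec assms(1) by auto
  have s: "s = t" if "t \<le> d" "\<delta> t \<noteq> 0" "\<And>i. i \<le> d \<Longrightarrow> t < i \<Longrightarrow> \<delta> i = 0" for t
  proof -
    have "i \<le> t" if "i \<le> d" "\<delta> i \<noteq> 0" for i
      using that \<open>\<And>i. i \<le> d \<Longrightarrow> t < i \<Longrightarrow> \<delta> i = 0\<close> by (meson not_less)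
    moreover have "finite {i. i \<le> d \<and> \<delta> i \<noteq> 0}" by (rule finite_subset[of _ "{..d}"]) auto
    ultimately show ?thesis unfolding assms(7) using that(1,2) by (intro Max_eqI) auto
  qed
  have positive: "\<forall>i\<in>{1..d}. 0 \<le> \<delta> i" using assms(3) by auto
  have "sum \<delta> {0..d} = \<delta> 0 + sum \<delta> {1..d}" by (simp add: sum.atLeast_Suc_atMost)
  then have "sum \<delta> {1..d} \<le> 2" using assms(4,6) by simp
  with finite_atLeastAtMost[of 1 d] positive show ?thesis
  proof (cases rule: small_sum_cases)
    case zero
    then have \<delta>: "\<delta> i = of_bool (i = 0)" if "i \<le> d" for i
      using that assms(4) by (cases "i = 0") auto
    have "s = 0" by (rule s) (use \<delta> in auto)
    moreover have "(\<Sum>j=1..i. \<delta> (d - j)) = 0" if "i \<le> (d - 1) div 2" for i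
      using that \<delta> by (intro sum.neutral) auto
    moreover have "(\<Sum>j=2..i + 1. \<delta> j) = 0" if "1 \<le> i" "i \<le> (d - 1) div 2" for i
      using that \<delta> by (intro sum.neutral) auto
    ultimately have ?ineq by auto
    moreover have ?ex
    proof (rule simplex_with_cyclic_boxes[where 'n = 'n, of 1 0 1])
      fix P :: "(real ^ 'n) set"
      assume "integral_polytope P" "aff_dim P = int CARD('n)"
        "\<And>n. delta_coeff P n = (\<Sum>j<1. of_bool (1 * (j mod 1) + 0 * (2 * j mod 1) = 1 * n))"
      then show ?ex using \<delta> by (intro realize) (auto simp: of_bool_def)
    qed auto
    ultimately show ?thesis by blast
  next
    case (one k)
    then have k: "1 \<le> k" "k \<le> d" by auto
    have \<delta>: "\<delta> i = of_bool (i = 0) + of_bool (i = k)" if "i \<le> d" for i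
      using one that assms(4) k by (cases "i = 0") auto
    have "s = k" by (rule s) (use \<delta> k in auto)
    have "k < d" using assms(2,5) \<delta>[of 1] \<delta>[of d] k by (auto simp: of_bool_def split: if_splits)
    have "?ex \<longleftrightarrow> 2 * k \<le> d + 1"
    proof
      assume ?ex
      then obtain P :: "(real ^ 'n) set" where P: "integral_polytope P" "aff_dim P = int CARD('n)"
        "\<And>i. i \<le> d \<Longrightarrow> delta_coeff P i = \<delta> i" using realized by blast
      have "k + k \<le> CARD('n) + 1"
        by (rule delta_gap_bounds(2)[OF P(1,2)]) (use k P(3) \<delta> assms(1) in auto)
      then show "2 * k \<le> d + 1" using assms(1) by simp
    next
      assume "2 * k \<le> d + 1"
      show ?ex
      proof (rule simplex_with_cyclic_boxes[where 'n = 'n, of "2 * k" 0 2])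
        fix P :: "(real ^ 'n) set"
        assume P: "integral_polytope P" "aff_dim P = int CARD('n)"
          "\<And>n. delta_coeff P n = (\<Sum>j<2. of_bool (2 * k * (j mod 2) + 0 * (2 * j mod 2) = 2 * n))"
        have "delta_coeff P i = \<delta> i" if "i \<le> d" for i
          unfolding P(3) \<delta>[OF that] by (auto simp: numeral_2_eq_2 of_bool_def)
        then show ?ex using P by (intro realize)
      qed (use k \<open>2 * k \<le> d + 1\<close> assms(1) in auto)
    qed
    then show ?thesis
      unfolding \<open>s = k\<close> using inequalities_iff_one[OF k(1) \<open>k < d\<close> \<delta>] by simp
  next
    case (two k l)
    define a where "a = min k l"
    define b where "b = max k l"
    have ab: "1 \<le> a" "a \<le> b" "b \<le> d" using two(1,2) by (auto simp: a_def b_def)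
    have "of_bool (i = k) + of_bool (i = l) = (of_bool (i = a) + of_bool (i = b) :: int)" for i
      by (auto simp: a_def b_def min_def max_def)
    then have \<delta>: "\<delta> i = of_bool (i = 0) + (of_bool (i = a) + of_bool (i = b))" if "i \<le> d" for i
      using two(3)[of i] that assms(4) ab by (cases "i = 0") auto
    have "s = b" by (rule s) (use \<delta> ab in auto)
    have "?ex \<longleftrightarrow> b \<le> 2 * a \<and> a + b \<le> d + 1"
    proof
      assume ?ex
      then obtain P :: "(real ^ 'n) set" where P: "integral_polytope P" "aff_dim P = int CARD('n)"
        "\<And>i. i \<le> d \<Longrightarrow> delta_coeff P i = \<delta> i" using realized by blast
      have "b \<le> 2 * a"
        by (rule delta_gap_bounds(1)[OF P(1,2)]) (use ab P(3) \<delta> assms(1) in auto)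
      moreover have "a + b \<le> CARD('n) + 1"
        by (rule delta_gap_bounds(2)[OF P(1,2)]) (use ab P(3) \<delta> assms(1) in auto)
      ultimately show "b \<le> 2 * a \<and> a + b \<le> d + 1" using assms(1) by simp
    next
      assume *: "b \<le> 2 * a \<and> a + b \<le> d + 1"
      \<comment> \<open>The solution of \<open>p + 2 q = 3 a\<close> and \<open>2 p + q = 3 b\<close>, the heights of the two nonzero
        box points being \<open>a\<close> and \<open>b\<close>.\<close>
      define p where "p = 2 * b - a"
      define q where "q = 2 * a - b"
      have pq: "p + 2 * q = 3 * a" "2 * p + q = 3 * b" using * ab by (auto simp: p_def q_def)
      show ?ex
      proof (rule simplex_with_cyclic_boxes[where 'n = 'n, of p q 3])
        fix P :: "(real ^ 'n) set"
        assume P: "integral_polytope P" "aff_dim P = int CARD('n)"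
          "\<And>n. delta_coeff P n = (\<Sum>j<3. of_bool (p * (j mod 3) + q * (2 * j mod 3) = 3 * n))"
        have sum3: "(\<Sum>j<3. g j) = g 0 + g 1 + g 2" for g :: "nat \<Rightarrow> int"
          by (simp add: eval_nat_numeral)
        have "delta_coeff P i = of_bool (0 = 3 * i) + of_bool (p + 2 * q = 3 * i)
            + of_bool (2 * p + q = 3 * i)" for i
          unfolding P(3) sum3 by (simp add: mult.commute)
        then have "delta_coeff P i = \<delta> i" if "i \<le> d" for i
          unfolding pq \<delta>[OF that] by (auto simp: of_bool_def)
        then show ?ex using P by (intro realize)
      qed (use * ab pq assms(1) in \<open>auto simp: p_def q_def\<close>)
    qed
    then show ?thesis
      unfolding \<open>s = b\<close> using inequalities_iff_two[OF ab assms(2,5) \<delta>] by simp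
  qed
qed

end
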